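(* Let $d\ge1$, $\Omega=[0,1]^d$ and $s\ge0$. Then for any $M>0$ and any $\epsilon>0$, $$\limsup_{n\rightarrow \infty} \left[\sup_{\|f\|_{\mathcal{B}^s(\Omega)} \leq 1}\ \inf_{f_n\in\Sigma^\infty_{n,M}} \|f - f_n\|_{L^2(\Omega)}\right]n^{\frac{1}{2} + \frac{s}{d} + \epsilon} = \infty .$$
   Context: The Fourier transform is $\hat g(\xi)=\int_{\mathbb{R}^d} g(x)e^{-2\pi \mathrm{i}\,\xi\cdot x}\,dx$, and $|\cdot|$ is the Euclidean norm. For $s\ge 0$, the spectral Barron space is $$\mathcal{B}^s(\Omega)=\Big\{f:\Omega\to\mathbb{C}:\ \|f\|_{\mathcal{B}^s(\Omega)}:=\inf_{f_e|_\Omega=f}\int_{\mathbb{R}^d}(1+|\xi|)^s|\hat f_e(\xi)|\,d\xi<\infty\Big\},$$ where the infimum is over extensions $f_e\in L^1(\mathbb{R}^d)$ of $f$. For $n\ge1$ and $M>0$ (coefficients bounded in $\ell^\infty$), $$\Sigma^\infty_{n,M}=\Big\{\sum_{j=1}^n a_je^{2\pi \mathrm{i}\,\theta_j\cdot x}:\ \theta_j\in\mathbb{R}^d,\ a_j\in\mathbb{C},\ |a_j|\le M\Big\}.$$ *)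

theory Defs
  imports "HOL-Analysis.Analysis"
begin

definition fourier_transform :: "(real ^ 'd \<Rightarrow> complex) \<Rightarrow> real ^ 'd \<Rightarrow> complex" where
  "fourier_transform g \<xi> =
     (LINT x|lebesgue. g x * exp (- 2 * complex_of_real pi * \<i> * complex_of_real (\<xi> \<bullet> x)))"

(* A function on Omega is represented by a total function of which only the values on Omega
   matter, and an element of L^1 by a Lebesgue integrable function.  Since Lebesgue measure is
   complete, every representative on Omega of the restriction of an L^1 class is the pointwise
   restriction of some representative of that class; so pointwise agreement on Omega gives the
   same infimum as agreement almost everywhere.  The norm is infinite if f has no extension. *)
definition barron_norm :: "real \<Rightarrow> (real ^ 'd) set \<Rightarrow> (real ^ 'd \<Rightarrow> complex) \<Rightarrow> ennreal" where
  "barron_norm s \<Omega> f =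
     (INF f\<^sub>e \<in> {f\<^sub>e. integrable lebesgue f\<^sub>e \<and> (\<forall>x\<in>\<Omega>. f\<^sub>e x = f x)}.
        \<integral>\<^sup>+ \<xi>. ennreal ((1 + norm \<xi>) powr s * cmod (fourier_transform f\<^sub>e \<xi>)) \<partial>lebesgue)"

(* The case distinction only extends the square root by sqrt \<infinity> = \<infinity>. *)
definition L2_norm_on :: "(real ^ 'd) set \<Rightarrow> (real ^ 'd \<Rightarrow> complex) \<Rightarrow> ennreal" where
  "L2_norm_on \<Omega> h =
     (let I = \<integral>\<^sup>+ x. ennreal ((cmod (h x))\<^sup>2) \<partial>lebesgue_on \<Omega>
      in if I = \<infinity> then \<infinity> else ennreal (sqrt (enn2real I)))"

definition Sigma_inf :: "nat \<Rightarrow> real \<Rightarrow> (real ^ 'd \<Rightarrow> complex) set" where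
  "Sigma_inf n M =
     {(\<lambda>x. \<Sum>j=1..n. a j * exp (2 * complex_of_real pi * \<i> * complex_of_real (\<theta> j \<bullet> x))) |
        (a :: nat \<Rightarrow> complex) (\<theta> :: nat \<Rightarrow> real ^ 'd). \<forall>j\<in>{1..n}. cmod (a j) \<le> M}"

definition unit_cube :: "(real ^ 'd) set" where
  "unit_cube = {x. \<forall>i. 0 \<le> x $ i \<and> x $ i \<le> 1}"

end

theory Submission
  imports Defs "HOL-Probability.Probability" "HOL-Real_Asymp.Real_Asymp"
begin

text \<open>
  The lower bound is a counting argument. Let \<open>N\<close> be large, let \<open>K\<close> be the set of the \<open>N\<^sup>d\<close>
  frequencies in \<open>{0,\<dots>,N-1}\<^sup>d\<close>, and attach to each \<open>c \<subseteq> K\<close> the function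
  \<open>\<tau> G(x) \<Sum>k\<in>c. e\<^sub>k(x)\<close>, where \<open>e\<^sub>k(x) = exp (2\<pi>\<i> k \<bullet> x)\<close> and \<open>G\<close> is a Gaussian. The Fourier
  transform of \<open>G e\<^sub>k\<close> is a Gaussian centred at \<open>k\<close>, so its weighted \<open>L\<^sup>1\<close> norm is at most a constant times
  \<open>N\<^sup>s\<close>, and with \<open>\<tau>\<close> of order \<open>N powr (- s - d)\<close> all these \<open>2 ^ (N\<^sup>d)\<close> functions lie in the unit ball
  of the Barron space. The exponentials \<open>e\<^sub>k\<close> are orthonormal on the cube and \<open>G \<ge> 1\<close> there, so
  two sets that differ in at least an eighth of the frequencies give functions at distance of order
  \<open>\<tau> N powr (d/2)\<close>, that is \<open>N powr (- s - d/2)\<close>.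

  An element of \<open>Sigma_inf n M\<close> has only \<open>n (d + 2)\<close> real parameters. The coefficients are bounded
  by \<open>M\<close>, but the frequencies are not, so the approximants are compared only through their pairings
  with \<open>e\<^sub>k / G\<close> on the cube, for \<open>k \<in> K\<close>. The pairing with \<open>exp (2\<pi>\<i> \<theta> \<bullet> x)\<close> is a product of
  one-dimensional integrals \<open>phi (\<theta>\<^sub>i - k\<^sub>i)\<close> (\<open>coef_wave\<close>). As \<open>phi\<close> is Lipschitz and decays at
  infinity, each \<open>\<theta>\<^sub>i\<close> may be clamped to an interval and then rounded (\<open>quantize_phi_close\<close>), with
  a polynomial number of values in \<open>N\<close>. Hence \<open>n\<close> terms produce only \<open>exp (O(n ln N))\<close> classes of
  approximants that these pairings can distinguish.

  If \<open>n\<close> is a power of \<open>N\<close> with exponent below \<open>d\<close>, that number is far below \<open>(4/3) ^ (N\<^sup>d)\<close>. As a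
  Hamming ball of radius \<open>N\<^sup>d / 8\<close> has at most \<open>(3/2) ^ (N\<^sup>d)\<close> elements, two sets at Hamming distance at
  least \<open>N\<^sup>d / 8\<close> then have approximants in the same class (\<open>far_collision\<close>). Pairing the
  difference of the two test functions with the same combination of the \<open>e\<^sub>k / G\<close> shows that one of them is approximated with an
  error of at least \<open>\<tau> N powr (d/2) / 8\<close> (\<open>packing_energy_le\<close>, \<open>entropy_lower_bound\<close>). Thus the error
  is at least \<open>c N powr (- s - d/2)\<close> for \<open>n\<close> of order \<open>N powr (d - \<beta>)\<close>, with any fixed \<open>0 < \<beta> < d\<close>
  (\<open>error_lower_bound\<close>). In terms of \<open>n\<close> the exponent is as close to \<open>-(1/2 + s/d)\<close> as desired, which
  beats the factor \<open>n powr (1/2 + s/d + \<epsilon>)\<close>.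
\<close>

section \<open>Counting subsets in a small Hamming ball\<close>

lemma sum_power_card_Pow:
  fixes x :: "'a::comm_semiring_1"
  assumes "finite K"
  shows "(\<Sum>e\<in>Pow K. x ^ card e) = (1 + x) ^ card K"
  using prod_add[OF assms, of "\<lambda>_. x" "\<lambda>_. 1"] by (simp add: add.commute)

text \<open>
  Each counted set has weight \<open>(1/4) ^ card e \<ge> (1/4) ^ (card K / 8) \<ge> (5/6) ^ card K\<close>, while all subsets of
  \<open>K\<close> together have weight \<open>(5/4) ^ card K\<close>; and \<open>5/4 = 3/2 * 5/6\<close>.
\<close>

lemma card_small_subsets_le:
  assumes "finite K"
  shows "real (card {e. e \<subseteq> K \<and> 8 * card e < card K}) \<le> (3/2) ^ card K"
proof -
  let ?E = "{e. e \<subseteq> K \<and> 8 * card e < card K}"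
  define D where "D = card K"
  have w: "(5/6::real) ^ D \<le> (1/4) ^ card e" if "e \<in> ?E" for e
  proof -
    have "((5/6::real) ^ D) ^ 8 = ((5/6) ^ 8) ^ D" by (simp flip: power_mult add: mult.commute)
    also have "\<dots> \<le> (1/4) ^ D" by (intro power_mono) (auto simp: power_divide)
    also have "\<dots> \<le> (1/4) ^ (8 * card e)" using that D_def by (intro power_decreasing) auto
    also have "\<dots> = ((1/4) ^ card e) ^ 8" by (simp flip: power_mult add: mult.commute)
    finally show ?thesis by (rule power_le_imp_le_base[of _ 7, simplified]) auto
  qed
  have "real (card ?E) * (5/6) ^ D = (\<Sum>e\<in>?E. (5/6) ^ D)" by simp
  also have "\<dots> \<le> (\<Sum>e\<in>?E. (1/4) ^ card e)" by (intro sum_mono w)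
  also have "\<dots> \<le> (\<Sum>e\<in>Pow K. (1/4) ^ card e)" using assms by (intro sum_mono2) auto
  also have "\<dots> = (3/2 * (5/6)) ^ D" using sum_power_card_Pow[OF assms, of "1/4::real"] by (simp add: D_def)
  finally show ?thesis unfolding D_def[symmetric] power_mult_distrib by simp
qed

text \<open>
  Otherwise every fibre of \<open>code\<close> would lie in a Hamming ball of radius below \<open>card K / 8\<close> around any of its elements,
  and \<open>card B\<close> fibres of this size could not cover all \<open>2 ^ card K = (4/3 * 3/2) ^ card K\<close> subsets.
\<close>

lemma far_collision:
  fixes code :: "'a set \<Rightarrow> 'b"
  assumes K: "finite K" and B: "finite B" "\<And>c. c \<subseteq> K \<Longrightarrow> code c \<in> B"
    and few: "real (card B) < (4/3) ^ card K"
  shows "\<exists>c c'. c \<subseteq> K \<and> c' \<subseteq> K \<and> code c = code c' \<and> card K \<le> 8 * card (c - c' \<union> (c' - c))"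
proof (rule ccontr)
  assume "\<not> ?thesis"
  then have close: "8 * card (c - c' \<union> (c' - c)) < card K" if "c \<subseteq> K" "c' \<subseteq> K" "code c = code c'" for c c'
    using that by (meson not_le)
  let ?E = "{e. e \<subseteq> K \<and> 8 * card e < card K}"
  have fibre: "real (card {c\<in>Pow K. code c = b}) \<le> (3/2) ^ card K" for b
  proof (cases "{c\<in>Pow K. code c = b} = {}")
    case False
    then obtain c' where c': "c' \<subseteq> K" "code c' = b" by auto
    have "card {c\<in>Pow K. code c = b} \<le> card ?E"
    proof (rule card_inj_on_le)
      show "inj_on (\<lambda>c. c - c' \<union> (c' - c)) {c\<in>Pow K. code c = b}" by (auto simp: inj_on_def)
      show "(\<lambda>c. c - c' \<union> (c' - c)) ` {c\<in>Pow K. code c = b} \<subseteq> ?E" using close c' by auto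
      show "finite ?E" using K by simp
    qed
    then show ?thesis using card_small_subsets_le[OF K] by linarith
  qed (metis card.empty of_nat_0 zero_le_power zero_le_divide_iff zero_le_numeral)
  have "Pow K = (\<Union>b\<in>B. {c\<in>Pow K. code c = b})" using B by auto
  then have "card (Pow K) \<le> (\<Sum>b\<in>B. card {c\<in>Pow K. code c = b})"
    using card_UN_le[OF B(1), of "\<lambda>b. {c\<in>Pow K. code c = b}"] by metis
  then have "real (2 ^ card K) \<le> real (\<Sum>b\<in>B. card {c\<in>Pow K. code c = b})"
    using card_Pow[OF K] by (simp only: of_nat_le_iff)
  also have "\<dots> \<le> real (card B) * (3/2) ^ card K"
    unfolding of_nat_sum using sum_bounded_above[of B, OF fibre] by simp
  also have "\<dots> < (4/3) ^ card K * (3/2) ^ card K" using few by simp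
  also have "\<dots> = 2 ^ card K" by (simp flip: power_mult_distrib)
  finally show False by simp
qed

section \<open>Integrals of products over the coordinates\<close>

lemma prod_Basis_vec:
  fixes f :: "real ^ 'd \<Rightarrow> 'b::comm_monoid_mult"
  shows "(\<Prod>b\<in>Basis. f b) = (\<Prod>i\<in>UNIV. f (axis i 1))"
proof -
  have 1: "(Basis :: (real^'d) set) = (\<lambda>i. axis i 1) ` UNIV" by (auto simp: Basis_vec_def)
  have 2: "inj (\<lambda>i::'d. axis i (1::real))" by (auto simp: inj_on_def axis_eq_axis)
  show ?thesis unfolding 1 prod.reindex[OF 2] by simp
qed

lemma
  fixes g :: "'d::finite \<Rightarrow> real \<Rightarrow> complex"
  assumes g: "\<And>i. integrable lborel (g i)"
  shows integrable_prod_vec: "integrable lborel (\<lambda>x::real^'d. \<Prod>i\<in>UNIV. g i (x $ i))"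
    and integral_prod_vec: "(LINT x|lborel. (\<Prod>i\<in>UNIV. g i ((x::real^'d) $ i))) = (\<Prod>i\<in>UNIV. LINT t|lborel. g i t)"
proof -
  interpret product_sigma_finite "\<lambda>b::real^'d. lborel :: real measure" ..
  have [measurable]: "g i \<in> borel_measurable borel" for i
    using borel_measurable_integrable[OF g[of i]] by simp
  \<comment> \<open>the coordinate that belongs to a basis vector\<close>
  let ?ix = "\<lambda>b. SOME i. b = axis (i::'d) (1::real)"
  have ix: "?ix (axis i 1) = i" for i by (auto simp: axis_eq_axis)
  have eq: "(\<Prod>i\<in>UNIV. g i (x $ i)) = (\<Prod>b\<in>Basis. g (?ix b) (x \<bullet> b))" for x :: "real^'d"
    unfolding prod_Basis_vec ix by (simp add: inner_axis)
  have eq': "(\<Prod>b\<in>Basis. g (?ix b) ((\<Sum>b\<in>Basis. f b *\<^sub>R b) \<bullet> b)) = (\<Prod>b\<in>(Basis::(real^'d) set). g (?ix b) (f b))" for f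
    by (intro prod.cong refl) simp
  have m: "(\<lambda>x::real^'d. \<Prod>b\<in>Basis. g (?ix b) (x \<bullet> b)) \<in> borel_measurable borel" by measurable
  show "integrable lborel (\<lambda>x::real^'d. \<Prod>i\<in>UNIV. g i (x $ i))"
    unfolding eq lborel_eq[where 'a="real^'d"]
    by (subst integrable_distr_eq) (use g m in \<open>auto simp: eq' intro!: product_integrable_prod\<close>)
  show "(LINT x|lborel. (\<Prod>i\<in>UNIV. g i ((x::real^'d) $ i))) = (\<Prod>i\<in>UNIV. LINT t|lborel. g i t)"
    unfolding eq lborel_eq[where 'a="real^'d"]
    by (subst integral_distr) (use g m in \<open>simp_all only: eq' product_integral_prod[OF finite_Basis g] prod_Basis_vec[of "\<lambda>b. LINT t|lborel. g (?ix b) t"] ix, measurable\<close>)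
qed

section \<open>Modulated Gaussians and their Barron norm\<close>

text \<open>Up to scaling, this is the characteristic function of the standard normal distribution.\<close>

lemma gaussian_fourier_1d:
  shows "integrable lborel (\<lambda>x::real. complex_of_real (exp ((1 - x\<^sup>2)/2)) * exp (2 * complex_of_real pi * \<i> * complex_of_real (b * x)))" (is ?A)
   and "(LINT x|lborel. complex_of_real (exp ((1 - x\<^sup>2)/2)) * exp (2 * complex_of_real pi * \<i> * complex_of_real (b * x)))
     = complex_of_real (sqrt (2 * pi * exp 1) * exp (- 2 * pi\<^sup>2 * b\<^sup>2))" (is ?B)
proof -
  let ?w = "\<lambda>x. exp (2 * complex_of_real pi * \<i> * complex_of_real (b * x))"
  define C where "C = sqrt (2 * pi * exp 1)"
  have C: "C \<noteq> 0" "C > 0" unfolding C_def by auto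
  have d: "exp ((1 - x\<^sup>2)/2) = C * std_normal_density x" for x :: real
  proof -
    have "sqrt (exp (1::real)) = exp (1/2)" by (intro real_sqrt_unique) (auto simp: power2_eq_square simp flip: exp_add)
    then show ?thesis
      by (simp add: C_def std_normal_density_def real_sqrt_mult diff_divide_distrib flip: exp_add)
  qed
  have int: "integrable lborel (\<lambda>x. complex_of_real (std_normal_density x) * ?w x)"
  proof (rule Bochner_Integration.integrable_bound[of _ std_normal_density])
    show "integrable lborel std_normal_density" by simp
    show "AE x in lborel. norm (complex_of_real (std_normal_density x) * ?w x) \<le> norm (std_normal_density x)"
      by (auto simp: norm_mult)
  qed simp
  show ?A unfolding d of_real_mult[of C] mult.assoc[of "complex_of_real C"] using int by (intro integrable_mult_right)
  have "char std_normal_distribution (2 * pi * b) = (LINT x|lborel. complex_of_real (std_normal_density x) * ?w x)"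
    unfolding char_def 
    by (subst integral_density) (auto simp: scaleR_conv_of_real mult_ac intro!: Bochner_Integration.integral_cong)
  then have "(LINT x|lborel. complex_of_real (std_normal_density x) * ?w x) = complex_of_real (exp (- 2 * pi\<^sup>2 * b\<^sup>2))"
    unfolding char_std_normal_distribution by (simp add: power_mult_distrib mult_ac)
  then show ?B unfolding d of_real_mult[of C] mult.assoc[of "complex_of_real C"] C_def[symmetric] by simp
qed

definition wave :: "real ^ 'd \<Rightarrow> real ^ 'd \<Rightarrow> complex" where
  "wave \<theta> x = exp (2 * complex_of_real pi * \<i> * complex_of_real (\<theta> \<bullet> x))"

text \<open>The Gaussian is scaled such that it is at least 1 on the unit cube: dividing by it does not increase absolute values there.\<close>

definition gauss :: "real ^ 'd \<Rightarrow> real" where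
  "gauss x = (\<Prod>i\<in>UNIV. exp ((1 - (x $ i)\<^sup>2) / 2))"

lemma wave_prod: "wave \<theta> x = (\<Prod>i\<in>UNIV. exp (2 * complex_of_real pi * \<i> * complex_of_real (\<theta> $ i * x $ i)))"
  unfolding wave_def inner_vec_def by (simp add: sum_distrib_left flip: exp_sum)

lemma cmod_wave [simp]: "cmod (wave \<theta> x) = 1"
  by (simp add: wave_def)

lemma continuous_on_wave [continuous_intros]: "continuous_on S (wave \<theta>)"
  unfolding wave_def by (intro continuous_intros)

lemma cnj_wave: "cnj (wave \<theta> x) = wave (- \<theta>) x"
  by (simp add: wave_def exp_cnj)

lemma wave_add: "wave (\<theta> + \<eta>) x = wave \<theta> x * wave \<eta> x"
  by (simp add: wave_def inner_add_left algebra_simps flip: exp_add)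

lemma continuous_on_gauss [continuous_intros]: "continuous_on S gauss"
  unfolding gauss_def by (intro continuous_intros) auto

lemma borel_measurable_wave [measurable]: "wave \<theta> \<in> borel_measurable borel"
  by (intro borel_measurable_continuous_onI continuous_intros)

lemma borel_measurable_gauss [measurable]: "gauss \<in> borel_measurable borel"
  by (intro borel_measurable_continuous_onI continuous_intros)

lemma gauss_pos: "gauss x > 0"
  unfolding gauss_def by (intro prod_pos) auto

lemma gauss_eq: "gauss (x :: real ^ 'd) = exp ((real CARD('d) - (norm x)\<^sup>2) / 2)"
  unfolding gauss_def power2_norm_eq_inner inner_vec_def
  by (simp add: power2_eq_square sum_subtractf flip: exp_sum sum_divide_distrib)

lemma
  fixes \<theta> :: "real ^ 'd"
  shows integrable_gauss_wave: "integrable lebesgue (\<lambda>x. complex_of_real (gauss x) * wave \<theta> x)"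
    and fourier_transform_gauss_wave: "fourier_transform (\<lambda>x. complex_of_real (gauss x) * wave \<theta> x) \<xi>
      = complex_of_real (sqrt (2 * pi * exp 1) ^ CARD('d) * exp (- 2 * pi\<^sup>2 * (norm (\<xi> - \<theta>))\<^sup>2))"
proof -
  let ?g = "\<lambda>b t. complex_of_real (exp ((1 - t\<^sup>2)/2)) * exp (2 * complex_of_real pi * \<i> * complex_of_real (b * t))"
  have eq: "complex_of_real (gauss x) * wave \<eta> x = (\<Prod>i\<in>UNIV. ?g (\<eta> $ i) (x $ i))" for x \<eta> :: "real ^ 'd"
    unfolding gauss_def wave_prod of_real_prod by (simp only: prod.distrib)
  have "integrable lborel (\<lambda>x. complex_of_real (gauss x) * wave \<theta> x)"
    unfolding eq by (intro integrable_prod_vec gaussian_fourier_1d)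
  then show int: "integrable lebesgue (\<lambda>x. complex_of_real (gauss x) * wave \<theta> x)"
    by (subst integrable_completion) auto
  have shift: "wave \<theta> x * exp (- 2 * complex_of_real pi * \<i> * complex_of_real (\<xi> \<bullet> x)) = wave (\<theta> - \<xi>) x" for x
    unfolding wave_def by (simp add: inner_diff_left algebra_simps flip: exp_add)
  have "fourier_transform (\<lambda>x. complex_of_real (gauss x) * wave \<theta> x) \<xi>
      = (LINT x|lborel. complex_of_real (gauss x) * wave (\<theta> - \<xi>) x)"
    unfolding fourier_transform_def mult.assoc[of "complex_of_real (gauss _)"] shift
    by (intro integral_completion) auto
  also have "\<dots> = (\<Prod>i\<in>UNIV. complex_of_real (sqrt (2 * pi * exp 1) * exp (- 2 * pi\<^sup>2 * ((\<theta> - \<xi>) $ i)\<^sup>2)))"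
    unfolding eq by (subst integral_prod_vec[of "\<lambda>i. ?g ((\<theta> - \<xi>) $ i)"]) (simp_all only: gaussian_fourier_1d)
  also have "\<dots> = complex_of_real (sqrt (2 * pi * exp 1) ^ CARD('d) * exp (- 2 * pi\<^sup>2 * (norm (\<theta> - \<xi>))\<^sup>2))"
    unfolding power2_norm_eq_inner inner_vec_def
    by (simp add: prod.distrib sum_distrib_left sum_negf power2_eq_square flip: exp_sum of_real_prod)
  finally show "fourier_transform (\<lambda>x. complex_of_real (gauss x) * wave \<theta> x) \<xi>
      = complex_of_real (sqrt (2 * pi * exp 1) ^ CARD('d) * exp (- 2 * pi\<^sup>2 * (norm (\<xi> - \<theta>))\<^sup>2))"
    by (simp add: norm_minus_commute)
qed

lemma integrable_gauss: "integrable lborel (gauss :: real ^ 'd \<Rightarrow> real)"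
proof -
  have "integrable lborel (\<lambda>x::real^'d. complex_of_real (gauss x) * wave 0 x)"
    using integrable_gauss_wave[of "0::real^'d"] by (subst (asm) integrable_completion) auto
  then have "integrable lborel (\<lambda>x::real^'d. complex_of_real (gauss x))" by (simp add: wave_def)
  then show ?thesis using complex_of_real_integrable_eq by blast
qed

text \<open>
  The weight is at most \<open>exp (s * norm y)\<close>, which \<open>s * r \<le> s\<^sup>2 + r\<^sup>2\<close> absorbs into part of the
  Gaussian decay; the remaining factor is bounded by \<open>gauss\<close>.
\<close>

lemma weighted_gauss_finite:
  fixes s :: real
  assumes "s \<ge> 0"
  shows "(\<integral>\<^sup>+ y. ennreal ((1 + norm y) powr s * exp (- 2 * pi\<^sup>2 * (norm (y :: real ^ 'd))\<^sup>2)) \<partial>lborel) < \<infinity>"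
proof -
  have "(1 + norm y) powr s * exp (- 2 * pi\<^sup>2 * (norm y)\<^sup>2) \<le> exp (s\<^sup>2) * gauss y" for y :: "real ^ 'd"
  proof -
    define r where "r = norm y"
    have r: "r \<ge> 0" by (simp add: r_def)
    have "pi * pi \<ge> 3 * 3" using pi_gt3 by (intro mult_mono) auto
    then have "2 * pi\<^sup>2 \<ge> 3/2" by (simp add: power2_eq_square)
    then have "2 * pi\<^sup>2 * r\<^sup>2 \<ge> 3/2 * r\<^sup>2" by (intro mult_right_mono) auto
    moreover have "s * r \<le> s\<^sup>2 + r\<^sup>2"
    proof -
      have "0 \<le> s * r" using assms r by simp
      moreover have "0 \<le> (s - r)\<^sup>2" by simp
      ultimately show ?thesis by (simp add: power2_eq_square algebra_simps)
    qed
    ultimately have le: "s * r - 2 * pi\<^sup>2 * r\<^sup>2 \<le> s\<^sup>2 + (real CARD('d) - r\<^sup>2) / 2" by (simp add: field_simps)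
    have "(1 + r) powr s \<le> exp r powr s" using r assms exp_ge_add_one_self[of r] by (intro powr_mono2) auto
    also have "\<dots> = exp (s * r)" by (simp add: powr_def)
    finally have "(1 + r) powr s * exp (- 2 * pi\<^sup>2 * r\<^sup>2) \<le> exp (s * r) * exp (- 2 * pi\<^sup>2 * r\<^sup>2)" by simp
    also have "\<dots> \<le> exp (s\<^sup>2) * gauss y"
      unfolding gauss_eq r_def[symmetric] using le by (simp flip: exp_add)
    finally show ?thesis by (simp add: r_def)
  qed
  then have "(\<integral>\<^sup>+ y. ennreal ((1 + norm y) powr s * exp (- 2 * pi\<^sup>2 * (norm (y :: real ^ 'd))\<^sup>2)) \<partial>lborel)
     \<le> (\<integral>\<^sup>+ y. ennreal (exp (s\<^sup>2) * gauss (y :: real ^ 'd)) \<partial>lborel)"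
    by (intro nn_integral_mono ennreal_leI)
  also have "\<dots> < \<infinity>"
  proof -
    have "integrable lborel (\<lambda>y::real^'d. exp (s\<^sup>2) * gauss y)"
      by (intro integrable_mult_right integrable_gauss)
    then have "(\<integral>\<^sup>+ y. ennreal (exp (s\<^sup>2) * gauss (y :: real ^ 'd)) \<partial>lborel) = ennreal (LINT y|lborel. exp (s\<^sup>2) * gauss (y :: real ^ 'd))"
      by (intro nn_integral_eq_integral) (auto simp: gauss_pos less_imp_le)
    then show ?thesis by simp
  qed
  finally show ?thesis .
qed

text \<open>
  The weight is submultiplicative: \<open>1 + norm \<xi> \<le> (1 + norm \<theta>) * (1 + norm (\<xi> - \<theta>))\<close>. So moving the Gaussian to \<open>\<theta>\<close>
  costs only the weight at \<open>\<theta>\<close>.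
\<close>

lemma weighted_gauss_shift:
  fixes \<theta> :: "real ^ 'd"
  assumes s: "s \<ge> 0"
  shows "(\<integral>\<^sup>+ \<xi>. ennreal ((1 + norm \<xi>) powr s * exp (- 2 * pi\<^sup>2 * (norm (\<xi> - \<theta>))\<^sup>2)) \<partial>lborel)
    \<le> ennreal ((1 + norm \<theta>) powr s) * (\<integral>\<^sup>+ y. ennreal ((1 + norm y) powr s * exp (- 2 * pi\<^sup>2 * (norm (y :: real ^ 'd))\<^sup>2)) \<partial>lborel)"
proof -
  let ?e = "\<lambda>y::real^'d. exp (- 2 * pi\<^sup>2 * (norm y)\<^sup>2)"
  have "(\<integral>\<^sup>+ \<xi>. ennreal ((1 + norm \<xi>) powr s * ?e (\<xi> - \<theta>)) \<partial>lborel)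
     \<le> (\<integral>\<^sup>+ \<xi>. ennreal ((1 + norm \<theta>) powr s) * ennreal ((1 + norm (\<xi> - \<theta>)) powr s * ?e (\<xi> - \<theta>)) \<partial>lborel)"
  proof (intro nn_integral_mono)
    fix \<xi> :: "real ^ 'd"
    have "norm \<xi> \<le> norm \<theta> + norm (\<xi> - \<theta>)" by norm
    then have "1 + norm \<xi> \<le> (1 + norm \<theta>) * (1 + norm (\<xi> - \<theta>))" 
      using mult_nonneg_nonneg[OF norm_ge_zero norm_ge_zero, of \<theta> "\<xi> - \<theta>"] unfolding ring_distribs by linarith
    then have "(1 + norm \<xi>) powr s \<le> ((1 + norm \<theta>) * (1 + norm (\<xi> - \<theta>))) powr s" using s by (intro powr_mono2) auto
    also have "\<dots> = (1 + norm \<theta>) powr s * (1 + norm (\<xi> - \<theta>)) powr s" by (simp add: powr_mult)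
    finally show "ennreal ((1 + norm \<xi>) powr s * ?e (\<xi> - \<theta>)) \<le> ennreal ((1 + norm \<theta>) powr s) * ennreal ((1 + norm (\<xi> - \<theta>)) powr s * ?e (\<xi> - \<theta>))"
      by (subst ennreal_mult[symmetric]) (auto intro!: ennreal_leI simp: mult.assoc[symmetric])
  qed
  also have "\<dots> = ennreal ((1 + norm \<theta>) powr s) * (\<integral>\<^sup>+ \<xi>. ennreal ((1 + norm (\<xi> - \<theta>)) powr s * ?e (\<xi> - \<theta>)) \<partial>lborel)"
    by (intro nn_integral_cmult) measurable
  also have "(\<integral>\<^sup>+ \<xi>. ennreal ((1 + norm (\<xi> - \<theta>)) powr s * ?e (\<xi> - \<theta>)) \<partial>lborel) = (\<integral>\<^sup>+ y. ennreal ((1 + norm y) powr s * ?e y) \<partial>distr lborel borel (\<lambda>y. - \<theta> + y))"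
    by (subst nn_integral_distr) (auto simp: algebra_simps)
  also have "distr lborel borel (\<lambda>y. - \<theta> + y) = (lborel :: (real ^ 'd) measure)"
    by (rule lborel_distr_plus)
  finally show ?thesis .
qed

lemma barron_norm_le:
  fixes \<theta> :: "'k \<Rightarrow> real ^ 'd" and b :: "'k \<Rightarrow> complex"
  assumes s: "s \<ge> 0"
  shows "barron_norm s \<Omega> (\<lambda>x. \<Sum>k\<in>K. b k * (complex_of_real (gauss x) * wave (\<theta> k) x))
    \<le> (\<Sum>k\<in>K. ennreal (cmod (b k) * sqrt (2 * pi * exp 1) ^ CARD('d) * (1 + norm (\<theta> k)) powr s) *
        (\<integral>\<^sup>+ y. ennreal ((1 + norm y) powr s * exp (- 2 * pi\<^sup>2 * (norm (y :: real ^ 'd))\<^sup>2)) \<partial>lborel))"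
proof -
  let ?f = "\<lambda>x. \<Sum>k\<in>K. b k * (complex_of_real (gauss x) * wave (\<theta> k) x)"
  define A where "A = sqrt (2 * pi * exp 1) ^ CARD('d)"
  have A: "A \<ge> 0" unfolding A_def by simp
  let ?e = "\<lambda>y::real^'d. exp (- 2 * pi\<^sup>2 * (norm y)\<^sup>2)"
  have F: "fourier_transform ?f \<xi> = (\<Sum>k\<in>K. b k * complex_of_real (A * ?e (\<xi> - \<theta> k)))" for \<xi>
  proof -
    let ?w = "\<lambda>x. exp (- 2 * complex_of_real pi * \<i> * complex_of_real (\<xi> \<bullet> x))"
    have int: "integrable lebesgue (\<lambda>x. complex_of_real (gauss x) * wave (\<theta> k) x * ?w x)" for k
    proof (rule Bochner_Integration.integrable_bound[OF integrable_gauss_wave[of "\<theta> k"]])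
      have "(\<lambda>x. complex_of_real (gauss x) * wave (\<theta> k) x * ?w x) \<in> borel_measurable borel" by measurable
      then show "(\<lambda>x. complex_of_real (gauss x) * wave (\<theta> k) x * ?w x) \<in> borel_measurable lebesgue"
        by (simp add: measurable_completion)
    qed (simp add: norm_mult)
    have "fourier_transform ?f \<xi> = (LINT x|lebesgue. (\<Sum>k\<in>K. b k * (complex_of_real (gauss x) * wave (\<theta> k) x * ?w x)))"
      unfolding fourier_transform_def sum_distrib_right by (simp add: mult.assoc)
    also have "\<dots> = (\<Sum>k\<in>K. b k * fourier_transform (\<lambda>x. complex_of_real (gauss x) * wave (\<theta> k) x) \<xi>)"
      using int by (simp add: Bochner_Integration.integral_sum fourier_transform_def)
    finally show ?thesis by (simp add: fourier_transform_gauss_wave A_def)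
  qed
  have "barron_norm s \<Omega> ?f \<le> (\<integral>\<^sup>+ \<xi>. ennreal ((1 + norm \<xi>) powr s * cmod (fourier_transform ?f \<xi>)) \<partial>lebesgue)"
    unfolding barron_norm_def
    by (intro INF_lower CollectI conjI ballI refl Bochner_Integration.integrable_sum integrable_mult_right integrable_gauss_wave)
  also have "\<dots> \<le> (\<integral>\<^sup>+ \<xi>. (\<Sum>k\<in>K. ennreal (cmod (b k) * A) * ennreal ((1 + norm \<xi>) powr s * ?e (\<xi> - \<theta> k))) \<partial>lebesgue)"
  proof (intro nn_integral_mono)
    fix \<xi> :: "real ^ 'd"
    have "cmod (fourier_transform ?f \<xi>) \<le> (\<Sum>k\<in>K. cmod (b k * complex_of_real (A * ?e (\<xi> - \<theta> k))))"
      unfolding F by (rule norm_sum)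
    also have "\<dots> = (\<Sum>k\<in>K. cmod (b k) * A * ?e (\<xi> - \<theta> k))"
      using A by (simp add: norm_mult mult.assoc)
    finally have "(1 + norm \<xi>) powr s * cmod (fourier_transform ?f \<xi>) \<le> (1 + norm \<xi>) powr s * (\<Sum>k\<in>K. cmod (b k) * A * ?e (\<xi> - \<theta> k))"
      by (intro mult_left_mono) auto
    also have "\<dots> = (\<Sum>k\<in>K. (cmod (b k) * A) * ((1 + norm \<xi>) powr s * ?e (\<xi> - \<theta> k)))"
      by (simp add: sum_distrib_left mult_ac)
    finally show "ennreal ((1 + norm \<xi>) powr s * cmod (fourier_transform ?f \<xi>)) \<le> (\<Sum>k\<in>K. ennreal (cmod (b k) * A) * ennreal ((1 + norm \<xi>) powr s * ?e (\<xi> - \<theta> k)))"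
      using A by (simp add: sum_ennreal ennreal_leI flip: ennreal_mult)
  qed
  also have "\<dots> = (\<Sum>k\<in>K. ennreal (cmod (b k) * A) * (\<integral>\<^sup>+ \<xi>. ennreal ((1 + norm \<xi>) powr s * ?e (\<xi> - \<theta> k)) \<partial>lborel))"
    unfolding nn_integral_completion by (subst nn_integral_sum) (auto simp: nn_integral_cmult)
  also have "\<dots> \<le> (\<Sum>k\<in>K. ennreal (cmod (b k) * A) * (ennreal ((1 + norm (\<theta> k)) powr s) *
      (\<integral>\<^sup>+ y. ennreal ((1 + norm y) powr s * ?e y) \<partial>lborel)))"
    by (intro sum_mono mult_left_mono weighted_gauss_shift s) auto
  also have "\<dots> = (\<Sum>k\<in>K. ennreal (cmod (b k) * A * (1 + norm (\<theta> k)) powr s) *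
      (\<integral>\<^sup>+ y. ennreal ((1 + norm y) powr s * ?e y) \<partial>lborel))"
    using A by (simp add: ennreal_mult mult.assoc)
  finally show ?thesis unfolding A_def .
qed

section \<open>One-dimensional pairings\<close>

abbreviation harmonic :: "real \<Rightarrow> real \<Rightarrow> complex" where
  "harmonic t x \<equiv> exp (2 * complex_of_real pi * \<i> * complex_of_real (t * x))"

text \<open>
  The factor contributed by one coordinate when an exponential is divided by \<open>gauss\<close> and paired with an
  exponential over the cube; \<open>t\<close> is the difference of the two frequencies.
\<close>

definition phi :: "real \<Rightarrow> complex" where
  "phi t = (LBINT x:{0..1}. complex_of_real (exp ((x\<^sup>2 - 1) / 2)) * harmonic t x)"

lemma norm_integral_unit_interval_le:
  fixes f :: "real \<Rightarrow> complex"
  assumes "continuous_on {0..1} f" "\<And>x. x \<in> {0..1} \<Longrightarrow> cmod (f x) \<le> B"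
  shows "cmod (LBINT x:{0..1}. f x) \<le> B"
proof -
  have "cmod (LBINT x:{0..1}. f x) \<le> (LBINT x:{0..1}. cmod (f x))"
    using assms by (intro set_integral_norm_bound borel_integrable_atLeastAtMost')
  also have "\<dots> \<le> (LBINT x:{0..1::real}. B)"
    using assms by (intro set_integral_mono borel_integrable_atLeastAtMost' continuous_intros) auto
  also have "\<dots> = B" by (simp add: set_lebesgue_integral_def)
  finally show ?thesis .
qed

lemma cmod_harmonic_diff_le: "cmod (harmonic t x - harmonic t' x) \<le> 2 * pi * \<bar>t - t'\<bar> * \<bar>x\<bar>"
proof -
  have "harmonic t x - harmonic t' x = harmonic t' x * (iexp (2 * pi * (t - t') * x) - 1)"
    by (simp add: algebra_simps flip: exp_add)
  also have "cmod \<dots> = cmod (iexp (2 * pi * (t - t') * x) - 1)"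
    by (subst norm_mult) simp
  also have "\<dots> \<le> \<bar>2 * pi * (t - t') * x\<bar>"
    using iexp_approx1[of "2 * pi * (t - t') * x" 0] by simp
  finally show ?thesis by (simp add: abs_mult)
qed

lemma cmod_phi_le_1: "cmod (phi t) \<le> 1"
  unfolding phi_def
proof (intro norm_integral_unit_interval_le continuous_intros)
  fix x :: real assume "x \<in> {0..1}"
  then have "x\<^sup>2 \<le> 1" by (auto simp: power_le_one)
  then show "cmod (complex_of_real (exp ((x\<^sup>2 - 1) / 2)) * harmonic t x) \<le> 1" by (simp add: norm_mult)
qed auto

lemma phi_lipschitz: "cmod (phi t - phi t') \<le> 2 * pi * \<bar>t - t'\<bar>"
proof -
  let ?v = "\<lambda>x. complex_of_real (exp ((x\<^sup>2 - 1) / 2))"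
  have "phi t - phi t' = (LBINT x:{0..1}. ?v x * harmonic t x - ?v x * harmonic t' x)"
    unfolding phi_def
    by (intro set_integral_diff(2)[symmetric] borel_integrable_atLeastAtMost' continuous_intros) auto
  also have "cmod \<dots> \<le> 2 * pi * \<bar>t - t'\<bar>"
  proof (intro norm_integral_unit_interval_le continuous_intros)
    fix x :: real assume x: "x \<in> {0..1}"
    then have "x\<^sup>2 \<le> 1" by (auto simp: power_le_one)
    then have "cmod (?v x) \<le> 1" by simp
    moreover have "2 * pi * \<bar>t - t'\<bar> * \<bar>x\<bar> \<le> 2 * pi * \<bar>t - t'\<bar> * 1"
      using x by (intro mult_left_mono) auto
    then have "cmod (harmonic t x - harmonic t' x) \<le> 2 * pi * \<bar>t - t'\<bar>"
      using cmod_harmonic_diff_le[of t x t'] by linarith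
    ultimately have "cmod (?v x) * cmod (harmonic t x - harmonic t' x) \<le> 1 * (2 * pi * \<bar>t - t'\<bar>)"
      by (intro mult_mono) auto
    then show "cmod (?v x * harmonic t x - ?v x * harmonic t' x) \<le> 2 * pi * \<bar>t - t'\<bar>"
      by (simp only: norm_mult[symmetric] right_diff_distrib mult_1)
  qed auto
  finally show ?thesis .
qed

lemma has_vector_derivative_harmonic:
  "((\<lambda>x. harmonic t x) has_vector_derivative (2 * complex_of_real pi * \<i> * complex_of_real t * harmonic t x)) (at x within S)"
  by (auto intro!: derivative_eq_intros has_vector_derivative_real_field simp: field_simps)

text \<open>Integration by parts: with \<open>c = 2\<pi>\<i>t\<close>, the boundary terms and the remaining integral are each at most 1, so \<open>cmod (c * phi t) \<le> 3 \<le> 2\<pi>\<close>.\<close>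

lemma phi_decay:
  assumes t: "t \<noteq> 0"
  shows "cmod (phi t) \<le> 1 / \<bar>t\<bar>"
proof -
  let ?v = "\<lambda>x. complex_of_real (exp ((x\<^sup>2 - 1) / 2))"
  define c where "c = 2 * complex_of_real pi * \<i> * complex_of_real t"
  have c: "c \<noteq> 0" and cm: "cmod c = 2 * pi * \<bar>t\<bar>" using t by (auto simp: c_def norm_mult)
  have ex: "harmonic t x = exp (c * complex_of_real x)" for x by (simp add: c_def mult.assoc)
  have v: "(?v has_vector_derivative (complex_of_real (x * exp ((x\<^sup>2 - 1) / 2)))) (at x within S)" for x S
    by (intro has_vector_derivative_of_real) (auto intro!: derivative_eq_intros simp flip: has_real_derivative_iff_has_vector_derivative)
  have e: "((\<lambda>x. harmonic t x) has_vector_derivative (c * harmonic t x)) (at x within S)" for x S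
    using has_vector_derivative_harmonic[of t x S] by (simp only: c_def)
  let ?G = "\<lambda>x. ?v x * harmonic t x"
  let ?H = "\<lambda>x. complex_of_real (x * exp ((x\<^sup>2 - 1) / 2)) * harmonic t x"
  have "(LBINT x:{0..1}. c * ?G x + ?H x) = ?G 1 - ?G 0"
    unfolding set_lebesgue_integral_def
  proof (intro integral_FTC_atLeastAtMost)
    fix x :: real
    show "(?G has_vector_derivative c * ?G x + ?H x) (at x within {0..1})"
      by (rule has_vector_derivative_eq_rhs[OF has_vector_derivative_mult[OF v e]]) (simp add: algebra_simps)
    show "continuous_on {0..1} (\<lambda>x. c * ?G x + ?H x)" by (intro continuous_intros) auto
  qed simp
  moreover have "(LBINT x:{0..1}. c * ?G x + ?H x) = c * phi t + (LBINT x:{0..1}. ?H x)"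
    unfolding phi_def
    by (subst set_integral_add) (auto intro!: borel_integrable_atLeastAtMost' continuous_intros)
  ultimately have "c * phi t = ?G 1 - ?G 0 - (LBINT x:{0..1}. ?H x)" by (simp add: algebra_simps)
  then have "cmod (c * phi t) \<le> cmod (?G 1) + cmod (?G 0) + cmod (LBINT x:{0..1}. ?H x)"
    using norm_triangle_ineq4[of "?G 1 - ?G 0" "LBINT x:{0..1}. ?H x"] norm_triangle_ineq4[of "?G 1" "?G 0"] by simp
  also have "cmod (?G 1) \<le> 1" by (simp add: norm_mult)
  also have "cmod (?G 0) \<le> 1" by (simp add: norm_mult)
  also have "cmod (LBINT x:{0..1}. ?H x) \<le> 1"
  proof (intro norm_integral_unit_interval_le continuous_intros)
    fix x :: real assume x: "x \<in> {0..1}"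
    then have "x\<^sup>2 \<le> 1" by (auto simp: power_le_one)
    then have "x * exp ((x\<^sup>2 - 1) / 2) \<le> 1 * 1" using x by (intro mult_mono) auto
    then show "cmod (?H x) \<le> 1" using x by (simp add: norm_mult)
  qed auto
  finally have "2 * pi * \<bar>t\<bar> * cmod (phi t) \<le> 3" by (simp add: norm_mult cm)
  moreover have "6 * (\<bar>t\<bar> * cmod (phi t)) \<le> 2 * pi * (\<bar>t\<bar> * cmod (phi t))" using pi_gt3 by (intro mult_right_mono) auto
  ultimately have "\<bar>t\<bar> * cmod (phi t) \<le> 1" by (simp add: mult.assoc)
  then show ?thesis using t by (simp add: field_simps)
qed

lemma integral_harmonic_int:
  fixes m :: int
  assumes "m \<noteq> 0"
  shows "(LBINT x:{0..1}. harmonic (of_int m) x) = 0"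
proof -
  let ?c = "2 * complex_of_real pi * \<i> * complex_of_real (of_int m)"
  have "(LBINT x:{0..1}. ?c * harmonic (of_int m) x) = harmonic (of_int m) 1 - harmonic (of_int m) 0"
    unfolding set_lebesgue_integral_def
    by (intro integral_FTC_atLeastAtMost has_vector_derivative_harmonic continuous_intros) auto
  also have "harmonic (of_int m) 1 = 1" using exp_integer_2pi[of "of_int m"] by (simp add: mult_ac)
  finally show ?thesis using assms by simp
qed

section \<open>Rounding a parameter\<close>

text \<open>Clamping to \<open>[-R, R]\<close> before rounding makes the set of values finite although \<open>t\<close> is unbounded.\<close>

definition quantize :: "nat \<Rightarrow> real \<Rightarrow> real \<Rightarrow> int" where
  "quantize P R t = \<lfloor>real P * max (- R) (min R t)\<rfloor>"

lemma floor_eq_imp_close: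
  assumes "P > 0" "\<lfloor>real P * x\<rfloor> = \<lfloor>real P * y\<rfloor>"
  shows "\<bar>x - y\<bar> \<le> 1 / real P"
proof -
  have "\<bar>real P * x - real P * y\<bar> \<le> 1" using assms(2) by linarith
  then have "real P * \<bar>x - y\<bar> \<le> 1" by (simp add: abs_mult flip: right_diff_distrib)
  then show ?thesis using assms(1) by (simp add: field_simps)
qed

lemma quantize_range:
  assumes "R \<ge> 0"
  shows "quantize P R t \<in> {\<lfloor>- (real P * R)\<rfloor>..\<lfloor>real P * R\<rfloor>}"
proof -
  have "real P * (-R) \<le> real P * max (- R) (min R t)" by (intro mult_left_mono) auto
  moreover have "real P * max (- R) (min R t) \<le> real P * R" using assms by (intro mult_left_mono) auto
  ultimately show ?thesis unfolding quantize_def by (auto intro!: floor_mono)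
qed

text \<open>
  Equal rounded values leave two cases. Either neither frequency is clamped; then they differ by at most \<open>1 / P\<close>, and
  the Lipschitz bound applies. Or both have absolute value at least \<open>N + P\<close>; then they
  have distance at least \<open>P\<close> from every \<open>k < N\<close>, and both values of \<open>phi\<close> are at most \<open>1 / P\<close> by decay.
\<close>

lemma quantize_phi_close:
  assumes P: "P > 0" and code: "quantize P (real (N + P + 1)) t = quantize P (real (N + P + 1)) t'" and k: "k < N"
  shows "cmod (phi (t - real k) - phi (t' - real k)) \<le> 7 / real P"
proof -
  define R where "R = real (N + P + 1)"
  define u u' where "u = max (-R) (min R t)" and "u' = max (-R) (min R t')"
  have uu: "\<bar>u - u'\<bar> \<le> 1 / real P"
    using floor_eq_imp_close[OF P] code by (simp add: quantize_def R_def u_def u'_def)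
  have P1: "1 / real P \<le> 1" using P by simp
  consider "u = t" "u' = t'" | "\<bar>t\<bar> \<ge> R - 1" "\<bar>t'\<bar> \<ge> R - 1"
    using uu P1 unfolding u_def u'_def R_def by linarith
  then show ?thesis
  proof cases
    case 1
    have "cmod (phi (t - real k) - phi (t' - real k)) \<le> 2 * pi * \<bar>t - t'\<bar>"
      using phi_lipschitz[of "t - real k" "t' - real k"] by simp
    also have "\<dots> \<le> 7 * (1 / real P)"
      using uu 1 pi_less_4 pi_approx by (intro mult_mono) auto
    finally show ?thesis by simp
  next
    case 2
    have far: "cmod (phi (t - real k)) \<le> 1 / real P" if "\<bar>t\<bar> \<ge> R - 1" for t
    proof -
      have "\<bar>t - real k\<bar> \<ge> real P" using that k unfolding R_def by linarith
      moreover have "t - real k \<noteq> 0" using calculation P by auto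
      ultimately show ?thesis using phi_decay[of "t - real k"] P
        by (meson frac_le of_nat_0_less_iff order_refl order_trans zero_le_one)
    qed
    have "cmod (phi (t - real k) - phi (t' - real k)) \<le> cmod (phi (t - real k)) + cmod (phi (t' - real k))"
      by (rule norm_triangle_ineq4)
    also have "\<dots> \<le> 1 / real P + 1 / real P" using far 2 by (intro add_mono) auto
    also have "\<dots> \<le> 7 / real P" using divide_right_mono[of 2 7 "real P"] by simp
    finally show ?thesis .
  qed
qed

section \<open>Pairings on the unit cube\<close>

definition freq :: "('d \<Rightarrow> nat) \<Rightarrow> real ^ 'd" where
  "freq k = (\<chi> i. real (k i))"

lemma unit_cube_eq: "(unit_cube :: (real ^ 'd) set) = cbox 0 (\<chi> i. 1)"
  by (auto simp: unit_cube_def mem_box_cart)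

lemma compact_unit_cube: "compact (unit_cube :: (real ^ 'd) set)"
  unfolding unit_cube_eq by (rule compact_cbox)

lemma set_integrable_unit_cube:
  fixes f :: "real ^ 'd \<Rightarrow> 'b :: {banach, second_countable_topology}"
  shows "continuous_on UNIV f \<Longrightarrow> set_integrable lborel unit_cube f"
  unfolding set_integrable_def
  by (intro borel_integrable_compact compact_unit_cube) (auto intro: continuous_on_subset)

lemma set_integral_unit_cube_prod:
  fixes g :: "'d::finite \<Rightarrow> real \<Rightarrow> complex"
  assumes "\<And>i. continuous_on UNIV (g i)"
  shows "(LINT x:(unit_cube :: (real ^ 'd) set)|lborel. (\<Prod>i\<in>UNIV. g i (x $ i))) = (\<Prod>i\<in>UNIV. LBINT t:{0..1}. g i t)"
proof -
  have ind: "indicator unit_cube x *\<^sub>R (\<Prod>i\<in>UNIV. g i (x $ i)) = (\<Prod>i\<in>UNIV. indicator {0..1} (x $ i) *\<^sub>R g i (x $ i))"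
    for x :: "real ^ 'd"
  proof (cases "x \<in> unit_cube")
    case False
    then obtain i where "x $ i \<notin> {0..1}" by (auto simp: unit_cube_def)
    then have "(\<Prod>i\<in>UNIV. indicator {0..1} (x $ i) *\<^sub>R g i (x $ i)) = 0"
      by (intro prod_zero bexI[of _ i]) auto
    with False show ?thesis by simp
  qed (auto simp: unit_cube_def)
  have "integrable lborel (\<lambda>t. indicator {0..1} t *\<^sub>R g i t)" for i
    using borel_integrable_atLeastAtMost'[of 0 1 "g i"] assms[of i]
    by (auto simp: set_integrable_def intro: continuous_on_subset)
  then show ?thesis
    unfolding set_lebesgue_integral_def ind by (rule integral_prod_vec)
qed

lemma wave_freq_orthonormal:
  fixes k m :: "'d::finite \<Rightarrow> nat"
  shows "(LINT x:unit_cube|lborel. wave (freq k) x * cnj (wave (freq m) x)) = (if k = m then 1 else 0)"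
proof -
  have "(LINT x:unit_cube|lborel. wave (freq k) x * cnj (wave (freq m) x))
      = (LINT x:unit_cube|lborel. (\<Prod>i\<in>UNIV. harmonic (of_int (int (k i) - int (m i))) (x $ i)))"
    unfolding cnj_wave wave_add[symmetric] unfolding wave_prod by (simp add: freq_def)
  also have "\<dots> = (\<Prod>i\<in>UNIV. LBINT t:{0..1}. harmonic (of_int (int (k i) - int (m i))) t)"
    by (intro set_integral_unit_cube_prod continuous_intros)
  also have "\<dots> = (if k = m then 1 else 0)"
  proof (cases "k = m")
    case True
    then show ?thesis by (simp add: set_lebesgue_integral_def)
  next
    case False
    then obtain i where "int (k i) - int (m i) \<noteq> 0" by (auto simp: fun_eq_iff)
    then have "(LBINT t:{0..1}. harmonic (of_int (int (k i) - int (m i))) t) = 0" by (rule integral_harmonic_int)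
    then have "(\<Prod>i\<in>UNIV. LBINT t:{0..1}. harmonic (of_int (int (k i) - int (m i))) t) = 0" by (intro prod_zero) auto
    then show ?thesis using False by simp
  qed
  finally show ?thesis .
qed

text \<open>
  The pairing with \<open>wave (freq k) / gauss\<close>. By orthonormality these functionals are dual to the functions
  \<open>gauss * wave (freq k)\<close>: they read off the coefficients of a test function.
\<close>

definition coef :: "('d \<Rightarrow> nat) \<Rightarrow> (real ^ 'd \<Rightarrow> complex) \<Rightarrow> complex" where
  "coef k g = (LINT x:unit_cube|lborel. complex_of_real (1 / gauss x) * g x * cnj (wave (freq k) x))"

lemma continuous_on_inverse_gauss [continuous_intros]: "continuous_on S (\<lambda>x. 1 / gauss x)"
  by (intro continuous_intros) (use gauss_pos less_irrefl in metis)

lemma coef_wave: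
  fixes k :: "'d::finite \<Rightarrow> nat"
  shows "coef k (wave \<theta>) = (\<Prod>i\<in>UNIV. phi (\<theta> $ i - real (k i)))"
proof -
  let ?g = "\<lambda>i t. complex_of_real (exp ((t\<^sup>2 - 1) / 2)) * harmonic (\<theta> $ i - real (k i)) t"
  have g: "1 / gauss x = (\<Prod>i\<in>UNIV. exp (((x $ i)\<^sup>2 - 1) / 2))" for x :: "real ^ 'd"
  proof -
    have "exp (((x $ i)\<^sup>2 - 1) / 2) = 1 / exp ((1 - (x $ i)\<^sup>2) / 2)" for i
      using exp_minus[of "(1 - (x $ i)\<^sup>2) / 2"] unfolding minus_divide_left minus_diff_eq inverse_eq_divide .
    then show ?thesis unfolding gauss_def by (simp add: prod_dividef)
  qed
  have "complex_of_real (1 / gauss x) * wave \<theta> x * cnj (wave (freq k) x) = (\<Prod>i\<in>UNIV. ?g i (x $ i))" for x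
    unfolding cnj_wave mult.assoc[of _ "wave \<theta> x"] wave_add[symmetric] unfolding g wave_prod of_real_prod
    by (simp only: prod.distrib[symmetric]) (simp add: freq_def)
  then have "coef k (wave \<theta>) = (LINT x:unit_cube|lborel. (\<Prod>i\<in>UNIV. ?g i (x $ i)))"
    unfolding coef_def by simp
  also have "\<dots> = (\<Prod>i\<in>UNIV. phi (\<theta> $ i - real (k i)))"
    unfolding phi_def by (intro set_integral_unit_cube_prod continuous_intros) auto
  finally show ?thesis .
qed

lemma coef_sum_wave:
  fixes a :: "'j \<Rightarrow> complex"
  shows "coef k (\<lambda>x. \<Sum>j\<in>J. a j * wave (\<theta> j) x) = (\<Sum>j\<in>J. a j * coef k (wave (\<theta> j)))"
proof -
  let ?h = "\<lambda>j x. complex_of_real (1 / gauss x) * wave (\<theta> j) x * cnj (wave (freq k) x)"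
  have "set_integrable lborel unit_cube (\<lambda>x. a j * ?h j x)" for j
    by (intro set_integrable_unit_cube continuous_intros)
  then have "(LINT x:unit_cube|lborel. (\<Sum>j\<in>J. a j * ?h j x)) = (\<Sum>j\<in>J. LINT x:unit_cube|lborel. a j * ?h j x)"
    unfolding set_lebesgue_integral_def set_integrable_def scaleR_sum_right
    by (intro Bochner_Integration.integral_sum)
  moreover have "complex_of_real (1 / gauss x) * (\<Sum>j\<in>J. a j * wave (\<theta> j) x) * cnj (wave (freq k) x) = (\<Sum>j\<in>J. a j * ?h j x)" for x
    unfolding sum_distrib_left sum_distrib_right by (intro sum.cong refl) (simp only: mult_ac)
  ultimately show ?thesis
    unfolding coef_def by (simp only: set_integral_mult_right)
qed

lemma gauss_ge_1: "x \<in> unit_cube \<Longrightarrow> gauss x \<ge> 1"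
  unfolding gauss_def by (intro prod_ge_1) (auto simp: unit_cube_def power_le_one)

text \<open>
  With \<open>t = (\<Sum>k\<in>K. b k * wave (freq k))\<close>, orthonormality gives \<open>(\<Sum>k\<in>K. (b k)\<^sup>2)\<close> as the integral of \<open>t * cnj t\<close>. Replace the first factor by
  \<open>(h - h' + (g - g')) / gauss\<close>. Since \<open>gauss \<ge> 1\<close>, the terms with \<open>h\<close> and \<open>h'\<close> are bounded by Young's inequality
  \<open>u v \<le> v\<^sup>2 / 8 + 2 u\<^sup>2\<close>, which costs a quarter of that sum; the term with \<open>g - g'\<close> is a combination of
  differences of pairings. Here \<open>h\<close>, \<open>h'\<close> stand for the errors of two approximations and \<open>g\<close>, \<open>g'\<close> for the approximants.
\<close>

lemma packing_energy_le:
  fixes b :: "('d::finite \<Rightarrow> nat) \<Rightarrow> real" and h h' g g' :: "real ^ 'd \<Rightarrow> complex"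
  assumes K: "finite K"
    and cont: "continuous_on UNIV h" "continuous_on UNIV h'" "continuous_on UNIV g" "continuous_on UNIV g'"
    and eq: "\<And>x. complex_of_real (gauss x) * (\<Sum>k\<in>K. complex_of_real (b k) * wave (freq k) x) = h x - h' x + (g x - g' x)"
    and h: "(LINT x:unit_cube|lborel. (cmod (h x))\<^sup>2) \<le> r" and h': "(LINT x:unit_cube|lborel. (cmod (h' x))\<^sup>2) \<le> r"
  shows "3/4 * (\<Sum>k\<in>K. (b k)\<^sup>2) \<le> 4 * r + (\<Sum>k\<in>K. \<bar>b k\<bar> * cmod (coef k g - coef k g'))"
proof -
  define t where "t x = (\<Sum>k\<in>K. complex_of_real (b k) * wave (freq k) x)" for x
  define S where "S = (\<Sum>k\<in>K. (b k)\<^sup>2)"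
  let ?u = "\<lambda>x. complex_of_real (1 / gauss x) * (g x - g' x) * cnj (t x)"
  have ct: "continuous_on UNIV t" unfolding t_def by (intro continuous_intros)
  note cont = cont ct
  have cu: "continuous_on UNIV ?u" by (intro continuous_intros cont)
  have sum_int: "(LINT x:unit_cube|lborel. (\<Sum>k\<in>A. F k x)) = (\<Sum>k\<in>A. LINT x:unit_cube|lborel. F k x)"
    if "\<And>k. continuous_on UNIV (F k)" for A and F :: "('d \<Rightarrow> nat) \<Rightarrow> real ^ 'd \<Rightarrow> complex"
  proof -
    have "set_integrable lborel unit_cube (F k)" for k using that by (intro set_integrable_unit_cube)
    then show ?thesis unfolding set_lebesgue_integral_def set_integrable_def scaleR_sum_right
      by (intro Bochner_Integration.integral_sum)
  qed
  have "complex_of_real (LINT x:unit_cube|lborel. (cmod (t x))\<^sup>2) = (LINT x:unit_cube|lborel. t x * cnj (t x))"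
    unfolding complex_norm_square[symmetric] by (rule set_integral_complex_of_real[symmetric])
  also have "\<dots> = (LINT x:unit_cube|lborel. (\<Sum>k\<in>K. \<Sum>m\<in>K. complex_of_real (b k * b m) * (wave (freq k) x * cnj (wave (freq m) x))))"
  proof -
    have "t x * cnj (t x) = (\<Sum>k\<in>K. \<Sum>m\<in>K. complex_of_real (b k * b m) * (wave (freq k) x * cnj (wave (freq m) x)))" for x
      unfolding t_def cnj_sum sum_product
      by (intro sum.cong refl) (simp only: complex_cnj_mult complex_cnj_complex_of_real of_real_mult mult_ac)
    then show ?thesis by simp
  qed
  also have "\<dots> = (\<Sum>k\<in>K. \<Sum>m\<in>K. complex_of_real (b k * b m) * (LINT x:unit_cube|lborel. wave (freq k) x * cnj (wave (freq m) x)))"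
    by (subst sum_int, (intro continuous_intros)[1], subst sum_int, (intro continuous_intros)[1]) simp
  also have "\<dots> = (\<Sum>k\<in>K. \<Sum>m\<in>K. if k = m then complex_of_real (b k * b m) else 0)"
    unfolding wave_freq_orthonormal by (intro sum.cong refl) simp
  also have "\<dots> = complex_of_real S"
    using K by (simp add: S_def power2_eq_square)
  finally have S: "(LINT x:unit_cube|lborel. (cmod (t x))\<^sup>2) = S" by (simp only: of_real_eq_iff)
  have "(LINT x:unit_cube|lborel. ?u x) = (\<Sum>k\<in>K. complex_of_real (b k) * (coef k g - coef k g'))"
  proof -
    have "(LINT x:unit_cube|lborel. ?u x)
       = (LINT x:unit_cube|lborel. (\<Sum>k\<in>K. complex_of_real (b k) * (complex_of_real (1 / gauss x) * g x * cnj (wave (freq k) x) - complex_of_real (1 / gauss x) * g' x * cnj (wave (freq k) x))))"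
    proof -
      have "?u x = (\<Sum>k\<in>K. complex_of_real (b k) * (complex_of_real (1 / gauss x) * g x * cnj (wave (freq k) x) - complex_of_real (1 / gauss x) * g' x * cnj (wave (freq k) x)))" for x
        unfolding t_def cnj_sum sum_distrib_left sum_distrib_right by (intro sum.cong refl) (simp only: complex_cnj_mult complex_cnj_complex_of_real left_diff_distrib right_diff_distrib mult_ac)
      then show ?thesis by simp
    qed
    also have "\<dots> = (\<Sum>k\<in>K. complex_of_real (b k) * (coef k g - coef k g'))"
      unfolding coef_def
      by (subst sum_int, (intro continuous_intros cont)[1], intro sum.cong refl, subst set_integral_mult_right,
          subst set_integral_diff) (intro refl set_integrable_unit_cube continuous_intros cont)+
    finally show ?thesis .
  qed
  then have u: "cmod (LINT x:unit_cube|lborel. ?u x) \<le> (\<Sum>k\<in>K. \<bar>b k\<bar> * cmod (coef k g - coef k g'))"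
    using norm_sum[of "\<lambda>k. complex_of_real (b k) * (coef k g - coef k g')" K] by (simp add: norm_mult)
  have "S \<le> (LINT x:unit_cube|lborel. 1/4 * (cmod (t x))\<^sup>2 + 2 * (cmod (h x))\<^sup>2 + 2 * (cmod (h' x))\<^sup>2 + Re (?u x))"
    unfolding S[symmetric]
  proof (intro set_integral_mono set_integrable_unit_cube continuous_intros cont)
    fix x :: "real ^ 'd" assume x: "x \<in> unit_cube"
    define v where "v = 1 / gauss x"
    have v: "0 \<le> v" "v \<le> 1" using gauss_ge_1[OF x] by (auto simp: v_def)
    have young: "v * (cmod w * cmod (t x)) \<le> 1/8 * (cmod (t x))\<^sup>2 + 2 * (cmod w)\<^sup>2" for w
    proof -
      have "v * (cmod w * cmod (t x)) \<le> 1 * (cmod w * cmod (t x))" using v by (intro mult_right_mono) auto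
      moreover have "0 \<le> (cmod (t x) - 4 * cmod w)\<^sup>2" by simp
      ultimately show ?thesis by (simp add: power2_eq_square algebra_simps)
    qed
    have "complex_of_real v * complex_of_real (gauss x) = 1" using gauss_pos[of x] by (simp add: v_def flip: of_real_mult)
    then have tx: "t x = complex_of_real v * (h x - h' x + (g x - g' x))"
      unfolding eq[symmetric] t_def[symmetric] by (simp add: mult.assoc[symmetric])
    have "p * z = v * a * z - v * a' * z + v * c * z" if "p = v * (a - a' + c)" for p v a a' c z :: complex
      unfolding that by (simp add: algebra_simps)
    from this[OF tx] have "t x * cnj (t x) = complex_of_real v * h x * cnj (t x) - complex_of_real v * h' x * cnj (t x) + complex_of_real v * (g x - g' x) * cnj (t x)" .
    from arg_cong[OF this, of Re]
    have "(cmod (t x))\<^sup>2 = Re (complex_of_real v * h x * cnj (t x)) + - Re (complex_of_real v * h' x * cnj (t x)) + Re (complex_of_real v * (g x - g' x) * cnj (t x))"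
      unfolding complex_norm_square[symmetric] Re_complex_of_real plus_complex.sel minus_complex.sel by linarith
    also have "Re (complex_of_real v * h x * cnj (t x)) \<le> v * (cmod (h x) * cmod (t x))"
      using complex_Re_le_cmod[of "complex_of_real v * h x * cnj (t x)"] v by (simp add: norm_mult mult.assoc)
    also have "- Re (complex_of_real v * h' x * cnj (t x)) \<le> v * (cmod (h' x) * cmod (t x))"
      using abs_Re_le_cmod[of "complex_of_real v * h' x * cnj (t x)"] v by (simp add: norm_mult mult.assoc)
    finally show "(cmod (t x))\<^sup>2 \<le> 1/4 * (cmod (t x))\<^sup>2 + 2 * (cmod (h x))\<^sup>2 + 2 * (cmod (h' x))\<^sup>2 + Re (?u x)"
      using young[of "h x"] young[of "h' x"] unfolding v_def by linarith
  qed (simp add: less_imp_neq[OF gauss_pos, symmetric])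
  also have "\<dots> = 1/4 * S + 2 * (LINT x:unit_cube|lborel. (cmod (h x))\<^sup>2) + 2 * (LINT x:unit_cube|lborel. (cmod (h' x))\<^sup>2)
      + (LINT x:unit_cube|lborel. Re (?u x))"
  proof -
    have lin: "(LINT x:unit_cube|lborel. 1/4 * T x + 2 * H x + 2 * H' x + U x)
      = 1/4 * (LINT x:unit_cube|lborel. T x) + 2 * (LINT x:unit_cube|lborel. H x) + 2 * (LINT x:unit_cube|lborel. H' x) + (LINT x:unit_cube|lborel. U x)"
      if "continuous_on UNIV T" "continuous_on UNIV H" "continuous_on UNIV H'" "continuous_on UNIV U" for T H H' U :: "real ^ 'd \<Rightarrow> real"
    proof -
      note i = set_integrable_unit_cube
      have a: "set_integrable lborel unit_cube (\<lambda>x. 1/4 * T x)" by (intro i continuous_intros that)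
      have b: "set_integrable lborel unit_cube (\<lambda>x. 2 * H x)" by (intro i continuous_intros that)
      have c: "set_integrable lborel unit_cube (\<lambda>x. 2 * H' x)" by (intro i continuous_intros that)
      note ab = set_integral_add[OF a b]
      note abc = set_integral_add[OF ab(1) c]
      show ?thesis
        unfolding set_integral_add(2)[OF abc(1) i[OF that(4)]] abc(2) ab(2) set_integral_mult_right ..
    qed
    show ?thesis unfolding S[symmetric]
      by (rule lin) (intro continuous_intros cont cu)+
  qed
  also have "(LINT x:unit_cube|lborel. Re (?u x)) \<le> cmod (LINT x:unit_cube|lborel. ?u x)"
  proof -
    have "(LINT x:unit_cube|lborel. Re (?u x)) = Re (LINT x:unit_cube|lborel. ?u x)"
      using integral_Re[OF set_integrable_unit_cube[OF cu, unfolded set_integrable_def]]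
      unfolding set_lebesgue_integral_def scaleR_complex.sel real_scaleR_def .
    also have "\<dots> \<le> cmod (LINT x:unit_cube|lborel. ?u x)" by (rule complex_Re_le_cmod)
    finally show ?thesis .
  qed
  finally show ?thesis using u h h' unfolding S_def[symmetric] by linarith
qed

lemma L2_norm_on_unit_cube:
  fixes h :: "real ^ 'd \<Rightarrow> complex"
  assumes h: "continuous_on UNIV h"
  shows "L2_norm_on unit_cube h = ennreal (sqrt (LINT x:unit_cube|lborel. (cmod (h x))\<^sup>2))"
proof -
  define X where "X = (LINT x:unit_cube|lborel. (cmod (h x))\<^sup>2)"
  have "set_integrable lborel unit_cube (\<lambda>x. (cmod (h x))\<^sup>2)"
    by (intro set_integrable_unit_cube continuous_intros h)
  then have int: "integrable lborel (\<lambda>x. indicator unit_cube x *\<^sub>R (cmod (h x))\<^sup>2)"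
    by (simp add: set_integrable_def)
  have [measurable]: "unit_cube \<in> sets lebesgue" by (simp add: unit_cube_eq)
  have "(\<integral>\<^sup>+ x. ennreal ((cmod (h x))\<^sup>2) \<partial>lebesgue_on unit_cube)
      = (\<integral>\<^sup>+ x. ennreal (indicator unit_cube x *\<^sub>R (cmod (h x))\<^sup>2) \<partial>lborel)"
    by (subst nn_integral_restrict_space, simp, subst nn_integral_completion)
       (auto intro!: nn_integral_cong split: split_indicator)
  also have "\<dots> = ennreal X"
    unfolding X_def set_lebesgue_integral_def by (intro nn_integral_eq_integral int) auto
  finally have I: "(\<integral>\<^sup>+ x. ennreal ((cmod (h x))\<^sup>2) \<partial>lebesgue_on unit_cube) = ennreal X" .
  have "X \<ge> 0" unfolding X_def set_lebesgue_integral_def by (intro Bochner_Integration.integral_nonneg) auto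
  then show ?thesis unfolding L2_norm_on_def I Let_def X_def[symmetric] by simp
qed

section \<open>The family of test functions\<close>

definition freqs :: "nat \<Rightarrow> ('d \<Rightarrow> nat) set" where
  "freqs N = UNIV \<rightarrow>\<^sub>E {..<N}"

lemma finite_freqs: "finite (freqs N :: ('d::finite \<Rightarrow> nat) set)"
  unfolding freqs_def by (intro finite_PiE) auto

lemma card_freqs: "card (freqs N :: ('d::finite \<Rightarrow> nat) set) = N ^ CARD('d)"
  unfolding freqs_def by (simp add: card_PiE)

lemma norm_freq_le:
  fixes k :: "'d::finite \<Rightarrow> nat"
  assumes "k \<in> freqs N"
  shows "norm (freq k) \<le> real CARD('d) * real N"
proof -
  have "norm (freq k) \<le> (\<Sum>i\<in>UNIV. \<bar>freq k $ i\<bar>)" by (rule norm_le_l1_cart)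
  also have "\<dots> \<le> (\<Sum>i\<in>(UNIV :: 'd set). real N)"
    using assms by (intro sum_mono) (auto simp: freq_def freqs_def PiE_iff less_imp_le)
  finally show ?thesis by simp
qed

definition test_fun :: "real \<Rightarrow> ('d::finite \<Rightarrow> nat) set \<Rightarrow> real ^ 'd \<Rightarrow> complex" where
  "test_fun \<tau> c x = (\<Sum>k\<in>c. complex_of_real \<tau> * (complex_of_real (gauss x) * wave (freq k) x))"

lemma continuous_on_test_fun [continuous_intros]: "continuous_on S (test_fun \<tau> c)"
  unfolding test_fun_def by (intro continuous_intros)

text \<open>
  A bound on the Barron norm of \<open>gauss * wave (freq k)\<close> divided by \<open>N powr s\<close>, for all \<open>k\<close> with entries below \<open>N\<close>: the height of
  the transformed Gaussian, the weight \<open>(1 + norm (freq k)) powr s \<le> ((1 + d) * N) powr s\<close>, and the weighted integral of the centred Gaussian.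
  The summand 1 makes it positive, so that one may divide by it.
\<close>

definition barron_const :: "real \<Rightarrow> 'd::finite itself \<Rightarrow> real" where
  "barron_const s _ = 1 + sqrt (2 * pi * exp 1) ^ CARD('d) * (1 + real CARD('d)) powr s *
     enn2real (\<integral>\<^sup>+ y. ennreal ((1 + norm y) powr s * exp (- 2 * pi\<^sup>2 * (norm (y :: real ^ 'd))\<^sup>2)) \<partial>lborel)"

lemma barron_const_ge_1: "barron_const s TYPE('d::finite) \<ge> 1"
  unfolding barron_const_def by simp

lemma barron_norm_test_fun:
  fixes c :: "('d::finite \<Rightarrow> nat) set"
  assumes s: "s \<ge> 0" and N: "N \<ge> 1" and c: "c \<subseteq> freqs N"
  shows "barron_norm s \<Omega> (test_fun (1 / (barron_const s TYPE('d) * real N powr (s + real CARD('d)))) c) \<le> 1"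
proof -
  define d where "d = CARD('d)"
  define A where "A = sqrt (2 * pi * exp 1) ^ d"
  define J where "J = (\<integral>\<^sup>+ y. ennreal ((1 + norm y) powr s * exp (- 2 * pi\<^sup>2 * (norm (y :: real ^ 'd))\<^sup>2)) \<partial>lborel)"
  define B where "B = barron_const s TYPE('d)"
  define \<tau> where "\<tau> = 1 / (B * real N powr (s + real d))"
  have B: "B \<ge> 1" "B = 1 + A * (1 + real d) powr s * enn2real J"
    unfolding B_def using barron_const_ge_1[of s, where 'd='d] by (auto simp: barron_const_def A_def d_def J_def)
  have A: "A \<ge> 0" by (simp add: A_def)
  have J: "J = ennreal (enn2real J)" using weighted_gauss_finite[OF s, where 'd='d] by (simp add: J_def)
  have \<tau>: "\<tau> > 0" using B N by (simp add: \<tau>_def)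
  have cardc: "real (card c) \<le> real N powr real d"
    using card_mono[OF finite_freqs c] N by (simp add: card_freqs d_def powr_realpow flip: of_nat_power)
  have "barron_norm s \<Omega> (test_fun \<tau> c)
      \<le> (\<Sum>k\<in>c. ennreal (cmod (complex_of_real \<tau>) * A * (1 + norm (freq k)) powr s) * J)"
    unfolding test_fun_def A_def J_def d_def using s by (rule barron_norm_le)
  also have "\<dots> \<le> (\<Sum>k\<in>c. ennreal (\<tau> * A * ((1 + real d) * real N) powr s) * J)"
  proof (intro sum_mono mult_right_mono ennreal_leI)
    fix k assume "k \<in> c"
    then have "norm (freq k) \<le> real d * real N" using c norm_freq_le[of k N] by (auto simp: d_def)
    then have "1 + norm (freq k) \<le> (1 + real d) * real N" using N by (simp add: algebra_simps)
    then have "(1 + norm (freq k)) powr s \<le> ((1 + real d) * real N) powr s" using s by (intro powr_mono2) auto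
    then show "cmod (complex_of_real \<tau>) * A * (1 + norm (freq k)) powr s \<le> \<tau> * A * ((1 + real d) * real N) powr s"
      using A \<tau> by (simp add: mult_left_mono)
  qed simp
  also have "\<dots> = ennreal (real (card c) * (\<tau> * A * ((1 + real d) * real N) powr s * enn2real J))"
    using A \<tau> by (subst J) (simp add: ennreal_mult ennreal_of_nat_eq_real_of_nat)
  also have "\<dots> \<le> ennreal 1"
  proof (rule ennreal_leI)
    have "real (card c) * (\<tau> * A * ((1 + real d) * real N) powr s * enn2real J)
       \<le> real N powr real d * (\<tau> * A * ((1 + real d) * real N) powr s * enn2real J)"
      using A \<tau> cardc by (intro mult_right_mono) auto
    also have "\<dots> = \<tau> * real N powr (s + real d) * (A * (1 + real d) powr s * enn2real J)"
      using N by (simp add: powr_mult powr_add)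
    also have "\<dots> \<le> \<tau> * real N powr (s + real d) * B"
      using \<tau> B by (intro mult_left_mono) auto
    also have "\<dots> = 1" using B N by (simp add: \<tau>_def)
    finally show "real (card c) * (\<tau> * A * ((1 + real d) * real N) powr s * enn2real J) \<le> 1" .
  qed
  finally show ?thesis by (simp add: \<tau>_def B_def d_def)
qed

section \<open>Finitely many classes of approximants\<close>

lemma quantize_unclamped:
  assumes "P > 0" "quantize P R x = quantize P R y" "\<bar>x\<bar> \<le> R" "\<bar>y\<bar> \<le> R"
  shows "\<bar>x - y\<bar> \<le> 1 / real P"
proof -
  have "max (-R) (min R x) = x" "max (-R) (min R y) = y" using assms by auto
  then show ?thesis using floor_eq_imp_close[OF assms(1)] assms(2) by (simp add: quantize_def)
qed

text \<open>
  The clamping range \<open>N + P + 1\<close> for the frequencies is the one of \<open>quantize_phi_close\<close>; the range \<open>P\<close> for the coefficients never clamps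
  once \<open>P\<close> is at least the bound \<open>M\<close> on them.
\<close>

definition code_word :: "nat \<Rightarrow> nat \<Rightarrow> nat \<Rightarrow> (nat \<Rightarrow> complex) \<Rightarrow> (nat \<Rightarrow> real ^ 'd) \<Rightarrow> nat \<Rightarrow> ('d \<Rightarrow> int) \<times> int \<times> int" where
  "code_word n N P a \<theta> = (\<lambda>j\<in>{1..n}. (\<lambda>i. quantize P (real (N + P + 1)) (\<theta> j $ i), quantize P (real P) (Re (a j)), quantize P (real P) (Im (a j))))"

definition code_words :: "nat \<Rightarrow> nat \<Rightarrow> nat \<Rightarrow> (nat \<Rightarrow> ('d \<Rightarrow> int) \<times> int \<times> int) set" where
  "code_words n N P = (let Z = {- int (P * (N + P + 1))..int (P * (N + P + 1))} in {1..n} \<rightarrow>\<^sub>E (UNIV \<rightarrow>\<^sub>E Z) \<times> Z \<times> Z)"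

lemma finite_code_words: "finite (code_words n N P :: (nat \<Rightarrow> ('d::finite \<Rightarrow> int) \<times> int \<times> int) set)"
  unfolding code_words_def Let_def by (intro finite_PiE finite_cartesian_product) auto

lemma card_code_words:
  "card (code_words n N P :: (nat \<Rightarrow> ('d::finite \<Rightarrow> int) \<times> int \<times> int) set)
    = (2 * (P * (N + P + 1)) + 1) ^ ((CARD('d) + 2) * n)"
proof -
  define Z where "Z = {- int (P * (N + P + 1))..int (P * (N + P + 1))}"
  have Z: "card Z = 2 * (P * (N + P + 1)) + 1" 
  proof -
    have "card {- int q..int q} = 2 * q + 1" for q by simp
    then show ?thesis unfolding Z_def .
  qed
  have "card (code_words n N P :: (nat \<Rightarrow> ('d \<Rightarrow> int) \<times> int \<times> int) set) = (card Z ^ CARD('d) * (card Z * card Z)) ^ n"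
    unfolding code_words_def Let_def Z_def[symmetric] by (simp add: card_PiE card_cartesian_product)
  also have "\<dots> = card Z ^ ((CARD('d) + 2) * n)"
    by (simp add: power_add power_mult_distrib power2_eq_square power_mult)
  finally show ?thesis unfolding Z .
qed

lemma code_word_in_code_words: "code_word n N P a \<theta> \<in> code_words n N P"
proof -
  have 1: "quantize P (real (N + P + 1)) t \<in> {- int (P * (N + P + 1))..int (P * (N + P + 1))}" for t
  proof -
    have "- (real P * real (N + P + 1)) = of_int (- int (P * (N + P + 1)))" "real P * real (N + P + 1) = of_int (int (P * (N + P + 1)))" by (simp_all only: of_int_minus of_int_of_nat_eq flip: of_nat_mult)
    then show ?thesis using quantize_range[of "real (N + P + 1)" P t] by (simp only: floor_of_int)
  qed
  have 2: "quantize P (real P) t \<in> {- int (P * (N + P + 1))..int (P * (N + P + 1))}" for t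
  proof -
    have "- (real P * real P) = of_int (- int (P * P))" "real P * real P = of_int (int (P * P))" by simp_all
    then have "quantize P (real P) t \<in> {- int (P * P)..int (P * P)}"
      using quantize_range[of "real P" P t] by (simp only: floor_of_int)
    moreover have "int (P * P) \<le> int (P * (N + P + 1))" by (simp only: of_nat_le_iff) (intro mult_le_mono2, simp)
    ultimately show ?thesis by (simp only: atLeastAtMost_iff) linarith
  qed
  define Z where "Z = {- int (P * (N + P + 1))..int (P * (N + P + 1))}"
  show ?thesis
    using 1 2 unfolding code_word_def code_words_def Let_def Z_def[symmetric] by (auto simp only: PiE_iff restrict_apply restrict_extensional mem_Sigma_iff extensional_UNIV UNIV_I if_True)
qed

text \<open>
  All factors \<open>phi\<close> are at most 1 in absolute value, so a difference of products is bounded by the sum of the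
  differences of the factors; each of the \<open>n\<close> terms contributes \<open>2 / P\<close> from its coefficient and
  \<open>7 * M / P\<close> from each coordinate of its frequency.
\<close>

lemma coef_close:
  fixes \<theta> \<theta>' :: "nat \<Rightarrow> real ^ 'd"
  assumes P: "P > 0" and M: "0 \<le> M" "M \<le> real P" and k: "k \<in> freqs N"
    and a: "\<And>j. j \<in> {1..n} \<Longrightarrow> cmod (a j) \<le> M" and a': "\<And>j. j \<in> {1..n} \<Longrightarrow> cmod (a' j) \<le> M"
    and same: "code_word n N P a \<theta> = code_word n N P a' \<theta>'"
  shows "cmod (coef k (\<lambda>x. \<Sum>j=1..n. a j * wave (\<theta> j) x) - coef k (\<lambda>x. \<Sum>j=1..n. a' j * wave (\<theta>' j) x))
    \<le> real n * (2 + 7 * M * real CARD('d)) / real P"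
proof -
  let ?F = "\<lambda>\<theta> j. coef k (wave (\<theta> j))"
  have F1: "cmod (coef k (wave \<eta>)) \<le> 1" for \<eta> :: "real ^ 'd"
    unfolding coef_wave prod_norm[symmetric] by (intro prod_le_1) (simp add: cmod_phi_le_1)
  have termwise: "cmod (a j * ?F \<theta> j - a' j * ?F \<theta>' j) \<le> (2 + 7 * M * real CARD('d)) / real P" if j: "j \<in> {1..n}" for j
  proof -
    have eq: "quantize P (real (N + P + 1)) (\<theta> j $ i) = quantize P (real (N + P + 1)) (\<theta>' j $ i)"
      "quantize P (real P) (Re (a j)) = quantize P (real P) (Re (a' j))" "quantize P (real P) (Im (a j)) = quantize P (real P) (Im (a' j))" for i
      using fun_cong[OF same, of j] j by (auto simp: code_word_def fun_eq_iff)
    have "\<bar>Re (a j) - Re (a' j)\<bar> \<le> 1 / real P" "\<bar>Im (a j) - Im (a' j)\<bar> \<le> 1 / real P"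
      using eq(2,3) a[OF j] a'[OF j] M abs_Re_le_cmod[of "a j"] abs_Re_le_cmod[of "a' j"] abs_Im_le_cmod[of "a j"] abs_Im_le_cmod[of "a' j"]
      by (auto intro!: quantize_unclamped[OF P])
    then have aa: "cmod (a j - a' j) \<le> 2 / real P" using cmod_le[of "a j - a' j"] by simp
    have "cmod (?F \<theta> j - ?F \<theta>' j) \<le> (\<Sum>i\<in>UNIV. cmod (phi (\<theta> j $ i - real (k i)) - phi (\<theta>' j $ i - real (k i))))"
      unfolding coef_wave by (intro norm_prod_diff cmod_phi_le_1)
    also have "\<dots> \<le> (\<Sum>i\<in>(UNIV :: 'd set). 7 / real P)"
      using k by (intro sum_mono quantize_phi_close[OF P eq(1)]) (auto simp: freqs_def PiE_iff)
    finally have FF: "cmod (?F \<theta> j - ?F \<theta>' j) \<le> real CARD('d) * (7 / real P)" by simp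
    have "a j * ?F \<theta> j - a' j * ?F \<theta>' j = (a j - a' j) * ?F \<theta> j + a' j * (?F \<theta> j - ?F \<theta>' j)" by (simp add: algebra_simps)
    then have "cmod (a j * ?F \<theta> j - a' j * ?F \<theta>' j) \<le> cmod (a j - a' j) * cmod (?F \<theta> j) + cmod (a' j) * cmod (?F \<theta> j - ?F \<theta>' j)"
      by (metis norm_mult norm_triangle_ineq)
    also have "\<dots> \<le> 2 / real P * 1 + M * (real CARD('d) * (7 / real P))"
      using aa FF a'[OF j] F1 M by (intro add_mono mult_mono) auto
    also have "\<dots> = (2 + 7 * M * real CARD('d)) / real P" by (simp add: add_divide_distrib)
    finally show ?thesis .
  qed
  have "cmod ((\<Sum>j=1..n. a j * ?F \<theta> j) - (\<Sum>j=1..n. a' j * ?F \<theta>' j)) \<le> (\<Sum>j=1..n. (2 + 7 * M * real CARD('d)) / real P)"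
    unfolding sum_subtractf[symmetric] by (intro sum_norm_le termwise)
  then show ?thesis unfolding coef_sum_wave by simp
qed

section \<open>Lower bounds for the approximation error\<close>

text \<open>
  If all errors were below \<open>r = \<tau> * sqrt (N ^ d) / 8\<close>, two test functions whose sets differ in at least \<open>N ^ d / 8\<close> frequencies
  would have approximants with the same code word. With \<open>D = N ^ d\<close>, \<open>packing_energy_le\<close> would bound
  \<open>3/4 * \<tau>\<^sup>2 * D / 8 = 6 * \<tau>\<^sup>2 * D / 64\<close> by \<open>4 * r\<^sup>2 + \<tau>\<^sup>2 * D / 64 = 5 * \<tau>\<^sup>2 * D / 64\<close>.
\<close>

lemma entropy_lower_bound:
  fixes M s :: real
  defines "d \<equiv> CARD('d::finite)"
  assumes s: "s \<ge> 0" and N: "N \<ge> 1" and P: "P > 0" and M: "0 \<le> M" "M \<le> real P"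
    and \<tau>: "\<tau> = 1 / (barron_const s TYPE('d) * real N powr (s + real d))"
    and few: "real (2 * (P * (N + P + 1)) + 1) ^ ((d + 2) * n) < (4/3) ^ (N ^ d)"
    and fine: "real n * (2 + 7 * M * real d) / real P \<le> \<tau> / 64"
  shows "ennreal (\<tau> * sqrt (real (N ^ d)) / 8) \<le> (SUP f \<in> {f. barron_norm s (unit_cube :: (real ^ 'd) set) f \<le> 1}.
             INF f\<^sub>n \<in> Sigma_inf n M. L2_norm_on unit_cube (\<lambda>x. f x - f\<^sub>n x))"
proof (rule ccontr)
  define r where "r = \<tau> * sqrt (real (N ^ d)) / 8"
  let ?K = "freqs N :: ('d \<Rightarrow> nat) set"
  let ?g = "\<lambda>a \<theta> x. \<Sum>j=1..n. a j * wave (\<theta> j :: real ^ 'd) x"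
  assume "\<not> ?thesis"
  then have less: "(SUP f \<in> {f. barron_norm s (unit_cube :: (real ^ 'd) set) f \<le> 1}.
             INF f\<^sub>n \<in> Sigma_inf n M. L2_norm_on unit_cube (\<lambda>x. f x - f\<^sub>n x)) < ennreal r"
    by (simp add: r_def)
  have \<tau>0: "\<tau> > 0" using N barron_const_ge_1[of s, where 'd='d] by (simp add: \<tau>)
  have cont_g: "continuous_on UNIV (?g a \<theta>)" for a \<theta> by (intro continuous_intros)
  define good where "good c a \<theta> \<longleftrightarrow> (\<forall>j\<in>{1..n}. cmod (a j) \<le> M) \<and>
      (LINT x:unit_cube|lborel. (cmod (test_fun \<tau> c x - ?g a \<theta> x))\<^sup>2) \<le> r\<^sup>2" for c a \<theta>
  have "\<exists>a \<theta>. good c a \<theta>" if c: "c \<subseteq> ?K" for c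
  proof -
    have "barron_norm s (unit_cube :: (real ^ 'd) set) (test_fun \<tau> c) \<le> 1"
      unfolding \<tau> d_def by (rule barron_norm_test_fun[OF s N c])
    then have "(INF f\<^sub>n \<in> Sigma_inf n M. L2_norm_on unit_cube (\<lambda>x. test_fun \<tau> c x - f\<^sub>n x)) < ennreal r"
      using less by (intro le_less_trans[OF SUP_upper less]) simp
    then obtain f\<^sub>n where fn: "f\<^sub>n \<in> Sigma_inf n M" and L: "L2_norm_on unit_cube (\<lambda>x. test_fun \<tau> c x - f\<^sub>n x) < ennreal r"
      unfolding INF_less_iff by blast
    obtain a \<theta> where f: "f\<^sub>n = ?g a \<theta>" and a: "\<forall>j\<in>{1..n}. cmod (a j) \<le> M"
      using fn unfolding Sigma_inf_def wave_def by blast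
    have L2: "L2_norm_on unit_cube (\<lambda>x. test_fun \<tau> c x - ?g a \<theta> x)
        = ennreal (sqrt (LINT x:unit_cube|lborel. (cmod (test_fun \<tau> c x - ?g a \<theta> x))\<^sup>2))"
      by (intro L2_norm_on_unit_cube continuous_intros cont_g)
    have "\<not> r \<le> sqrt (LINT x:unit_cube|lborel. (cmod (test_fun \<tau> c x - ?g a \<theta> x))\<^sup>2)"
      using L[unfolded f L2] ennreal_leI not_le by blast
    then have "(LINT x:unit_cube|lborel. (cmod (test_fun \<tau> c x - ?g a \<theta> x))\<^sup>2) \<le> r\<^sup>2"
      by (intro sqrt_le_D) simp
    with a show ?thesis unfolding good_def by blast
  qed
  then obtain a \<theta> where "\<And>c. c \<subseteq> ?K \<Longrightarrow> good c (a c) (\<theta> c)" by metis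
  then have a: "\<And>c j. c \<subseteq> ?K \<Longrightarrow> j \<in> {1..n} \<Longrightarrow> cmod (a c j) \<le> M"
    and err: "\<And>c. c \<subseteq> ?K \<Longrightarrow> (LINT x:unit_cube|lborel. (cmod (test_fun \<tau> c x - ?g (a c) (\<theta> c) x))\<^sup>2) \<le> r\<^sup>2"
    unfolding good_def by blast+
  have "\<exists>c c'. c \<subseteq> ?K \<and> c' \<subseteq> ?K \<and> code_word n N P (a c) (\<theta> c) = code_word n N P (a c') (\<theta> c') \<and> card ?K \<le> 8 * card (c - c' \<union> (c' - c))"
    using few by (intro far_collision[OF finite_freqs finite_code_words[of n N P, where 'd='d]] code_word_in_code_words)
      (simp add: card_code_words card_freqs d_def)
  then obtain c c' where c: "c \<subseteq> ?K" "c' \<subseteq> ?K" and same: "code_word n N P (a c) (\<theta> c) = code_word n N P (a c') (\<theta> c')"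
    and far: "card ?K \<le> 8 * card (c - c' \<union> (c' - c))" by blast
  define D where "D = real (N ^ d)"
  have D: "D > 0" "D = real (card ?K)" using N by (auto simp: D_def card_freqs d_def)
  \<comment> \<open>the coefficients of the difference of the two test functions\<close>
  define b where "b k = \<tau> * (of_bool (k \<in> c) - of_bool (k \<in> c'))" for k
  have b1: "\<bar>b k\<bar> \<le> \<tau>" for k using \<tau>0 by (auto simp: b_def)
  have "complex_of_real (gauss x) * (\<Sum>k\<in>?K. complex_of_real (b k) * wave (freq k) x)
      = (test_fun \<tau> c x - ?g (a c) (\<theta> c) x) - (test_fun \<tau> c' x - ?g (a c') (\<theta> c') x) + (?g (a c) (\<theta> c) x - ?g (a c') (\<theta> c') x)" for x
  proof -
    have tf: "test_fun \<tau> e x = (\<Sum>k\<in>?K. of_bool (k \<in> e) * (complex_of_real \<tau> * (complex_of_real (gauss x) * wave (freq k) x)))" if "e \<subseteq> ?K" for e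
      unfolding test_fun_def using that by (intro sum.mono_neutral_cong_left finite_freqs) auto
    have "complex_of_real (gauss x) * (\<Sum>k\<in>?K. complex_of_real (b k) * wave (freq k) x) = test_fun \<tau> c x - test_fun \<tau> c' x"
      unfolding tf[OF c(1)] tf[OF c(2)] sum_subtractf[symmetric] sum_distrib_left b_def
      by (intro sum.cong refl) (auto simp: algebra_simps)
    then show ?thesis by simp
  qed
  then have "3/4 * (\<Sum>k\<in>?K. (b k)\<^sup>2) \<le> 4 * r\<^sup>2 + (\<Sum>k\<in>?K. \<bar>b k\<bar> * cmod (coef k (?g (a c) (\<theta> c)) - coef k (?g (a c') (\<theta> c'))))"
    by (intro packing_energy_le[OF finite_freqs _ _ _ _ _ err[OF c(1)] err[OF c(2)]]) (intro continuous_intros cont_g | assumption)+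
  also have "(\<Sum>k\<in>?K. \<bar>b k\<bar> * cmod (coef k (?g (a c) (\<theta> c)) - coef k (?g (a c') (\<theta> c')))) \<le> (\<Sum>k\<in>?K. \<tau> * (\<tau> / 64))"
  proof (intro sum_mono mult_mono b1)
    fix k assume k: "k \<in> ?K"
    have "cmod (coef k (?g (a c) (\<theta> c)) - coef k (?g (a c') (\<theta> c'))) \<le> real n * (2 + 7 * M * real CARD('d)) / real P"
      using a[OF c(1)] a[OF c(2)] by (intro coef_close[OF P M k _ _ same])
    also have "\<dots> \<le> \<tau> / 64" using fine unfolding d_def .
    finally show "cmod (coef k (?g (a c) (\<theta> c)) - coef k (?g (a c') (\<theta> c'))) \<le> \<tau> / 64" .
  qed (use \<tau>0 in auto)
  also have "\<dots> = \<tau>\<^sup>2 * D / 64" using D(2) by (simp add: power2_eq_square)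
  also have "4 * r\<^sup>2 = \<tau>\<^sup>2 * D / 16" by (simp add: r_def power_mult_distrib power_divide D_def)
  finally have up: "3/4 * (\<Sum>k\<in>?K. (b k)\<^sup>2) \<le> \<tau>\<^sup>2 * D / 16 + \<tau>\<^sup>2 * D / 64" by simp
  have "(\<Sum>k\<in>?K. (b k)\<^sup>2) = (\<Sum>k\<in>c - c' \<union> (c' - c). \<tau>\<^sup>2)"
    using c by (intro sum.mono_neutral_cong_right finite_freqs) (auto simp: b_def)
  also have "\<dots> = \<tau>\<^sup>2 * real (card (c - c' \<union> (c' - c)))" by simp
  also have "\<dots> \<ge> \<tau>\<^sup>2 * (D / 8)"
  proof (intro mult_left_mono)
    have "real (card ?K) \<le> real (8 * card (c - c' \<union> (c' - c)))" using far by (rule of_nat_mono)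
    then show "D / 8 \<le> real (card (c - c' \<union> (c' - c)))" unfolding D(2) by simp
  qed simp
  finally have "3/4 * (\<tau>\<^sup>2 * (D / 8)) \<le> \<tau>\<^sup>2 * D / 16 + \<tau>\<^sup>2 * D / 64" using up by linarith
  moreover have "\<tau>\<^sup>2 * D > 0" using \<tau>0 D(1) by simp
  ultimately show False by (simp add: mult.commute)
qed

text \<open>
  The precision \<open>P\<close> of the rounding may be a fixed power of \<open>N\<close>. Then the number \<open>Q\<close> of rounded values of one parameter is polynomial
  in \<open>N\<close>, and the logarithm of the number of code words is of order \<open>n * ln N \<le> N powr (d - \<beta>) * ln N\<close>, which \<open>N powr d\<close>
  exceeds in the limit.
\<close>

lemma error_lower_bound:
  fixes s M \<beta> :: real
  defines "d \<equiv> CARD('d::finite)"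
  assumes s: "s \<ge> 0" and M: "M > 0" and \<beta>: "\<beta> > 0" "\<beta> < real d"
  shows "\<exists>c>0. \<forall>\<^sub>F N in sequentially. ennreal (c * real N powr (- s - real d / 2))
     \<le> (SUP f \<in> {f. barron_norm s (unit_cube :: (real ^ 'd) set) f \<le> 1}.
             INF f\<^sub>n \<in> Sigma_inf (nat \<lfloor>real N powr (real d - \<beta>)\<rfloor>) M. L2_norm_on unit_cube (\<lambda>x. f x - f\<^sub>n x))"
proof (intro exI conjI)
  define B where "B = barron_const s TYPE('d)"
  have B: "B \<ge> 1" unfolding B_def by (rule barron_const_ge_1)
  show "1 / (8 * B) > 0" using B by simp
  \<comment> \<open>\<open>C * N powr a\<close> exceeds \<open>N\<close>, \<open>M\<close> and the precision that \<open>entropy_lower_bound\<close> needs for \<open>n \<le> N powr d\<close>\<close>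
  define C where "C = 64 * (2 + 7 * M * real d) * B + M + 1"
  have d: "d > 0" by (simp add: d_def)
  have C: "C \<ge> 1" "C \<ge> M" "C \<ge> 64 * (2 + 7 * M * real d) * B" using B M by (auto simp: C_def)
  define a where "a = s + 2 * real d"
  have a: "a \<ge> 1" using s d by (simp add: a_def)
  \<comment> \<open>\<open>28 * C\<^sup>2 * X powr (2 * a)\<close> will bound the number of rounded values of one parameter\<close>
  have "\<forall>\<^sub>F X in at_top. real (d + 2) * (ln (28 * C\<^sup>2) + 2 * a * ln X) < X powr \<beta> * ln (4/3)"
    using \<beta>(1) by real_asymp
  then have "\<forall>\<^sub>F N in sequentially. real (d + 2) * (ln (28 * C\<^sup>2) + 2 * a * ln (real N)) < real N powr \<beta> * ln (4/3)"
    using filterlim_real_sequentially unfolding filterlim_iff by blast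
  then show "\<forall>\<^sub>F N in sequentially. ennreal (1 / (8 * B) * real N powr (- s - real d / 2))
     \<le> (SUP f \<in> {f. barron_norm s (unit_cube :: (real ^ 'd) set) f \<le> 1}.
             INF f\<^sub>n \<in> Sigma_inf (nat \<lfloor>real N powr (real d - \<beta>)\<rfloor>) M. L2_norm_on unit_cube (\<lambda>x. f x - f\<^sub>n x))"
    using eventually_ge_at_top[of 1]
  proof eventually_elim
    case (elim N)
    define X where "X = real N"
    have X: "X \<ge> 1" using elim(2) by (simp add: X_def)
    have XD: "real (N ^ d) = X powr real d" using X by (simp add: X_def powr_realpow)
    define n where "n = nat \<lfloor>X powr (real d - \<beta>)\<rfloor>"
    have n: "real n \<le> X powr (real d - \<beta>)" unfolding n_def by (simp add: of_nat_floor)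
    define P where "P = nat \<lceil>C * X powr a\<rceil>"
    have Xa: "X powr a \<ge> X" using powr_mono[of 1 a X] X a by simp
    then have Xa1: "X powr a \<ge> 1" using X by linarith
    have CX: "C * X powr a \<ge> 1 * 1" using C Xa1 by (intro mult_mono) auto
    have P: "C * X powr a \<le> real P" "real P \<le> 2 * (C * X powr a)"
      using CX unfolding P_def by linarith+
    have P0: "P > 0" using P(1) CX by simp
    have "C * 1 \<le> C * X powr a" using C Xa1 by (intro mult_left_mono) auto
    then have PM: "M \<le> real P" using P(1) C by linarith
    have "1 * X \<le> C * X powr a" using C Xa X by (intro mult_mono) auto
    then have PN: "N \<le> P" using P(1) by (simp add: X_def)
    define \<tau> where "\<tau> = 1 / (B * X powr (s + real d))"
    have fine: "real n * (2 + 7 * M * real d) / real P \<le> \<tau> / 64"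
    proof -
      have "real n \<le> X powr real d" using n powr_mono[of "real d - \<beta>" "real d" X] X \<beta> by simp
      then have "64 * (2 + 7 * M * real d) * B * (real n * X powr (s + real d))
          \<le> C * (X powr real d * X powr (s + real d))"
        using C B M by (intro mult_mono) auto
      also have "X powr real d * X powr (s + real d) = X powr a"
        unfolding powr_add[symmetric] a_def by (simp add: algebra_simps)
      also note P(1)
      finally show ?thesis using P0 B X by (simp add: \<tau>_def field_simps)
    qed
    define Q where "Q = real (2 * (P * (N + P + 1)) + 1)"
    have Q: "Q \<ge> 1" by (simp add: Q_def)
    have "2 * (P * (N + P + 1)) + 1 \<le> 2 * (P * (3 * P)) + P * P"
      using PN P0 by (intro add_mono mult_le_mono2) auto
    then have "Q \<le> real (7 * P\<^sup>2)" unfolding Q_def of_nat_le_iff by (simp add: power2_eq_square)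
    also have "\<dots> \<le> 7 * (2 * (C * X powr a))\<^sup>2" 
      unfolding of_nat_mult of_nat_power of_nat_numeral by (intro mult_left_mono power_mono P(2)) auto
    also have "\<dots> = 28 * C\<^sup>2 * X powr (2 * a)" 
    proof -
      have "(X powr a)\<^sup>2 = X powr (2 * a)" by (simp add: power2_eq_square flip: powr_add)
      then show ?thesis by (simp add: power_mult_distrib)
    qed
    finally have "ln Q \<le> ln (28 * C\<^sup>2 * X powr (2 * a))" using Q by simp
    also have "\<dots> = ln (28 * C\<^sup>2) + 2 * a * ln X" using C X by (simp add: ln_mult)
    finally have lnQ: "ln Q \<le> ln (28 * C\<^sup>2) + 2 * a * ln X" .
    have "real ((d + 2) * n) * ln Q = real (d + 2) * ln Q * real n" by (simp only: of_nat_mult mult_ac)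
    also have "\<dots> \<le> real (d + 2) * ln Q * X powr (real d - \<beta>)" using n Q by (intro mult_left_mono) auto
    also have "\<dots> \<le> real (d + 2) * (ln (28 * C\<^sup>2) + 2 * a * ln X) * X powr (real d - \<beta>)"
      using lnQ by (intro mult_right_mono mult_left_mono) auto
    also have "\<dots> < X powr \<beta> * ln (4/3) * X powr (real d - \<beta>)"
      using elim(1) X by (intro mult_strict_right_mono) (auto simp: X_def)
    also have "\<dots> = X powr real d * ln (4/3)" by (simp add: powr_diff)
    also have "\<dots> = real (N ^ d) * ln (4/3)" unfolding XD ..
    finally have "ln (Q ^ ((d + 2) * n)) < ln ((4/3) ^ (N ^ d))" using Q by (simp add: ln_realpow)
    then have few: "Q ^ ((d + 2) * n) < (4/3) ^ (N ^ d)" using Q by (subst (asm) ln_less_cancel_iff) auto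
    have "1 / (8 * B) * X powr (- s - real d / 2) = \<tau> * sqrt (real (N ^ d)) / 8"
    proof -
      have "sqrt (X powr real d) = X powr (real d / 2)" using X by (simp add: powr_half_sqrt[symmetric] powr_powr)
      moreover have "- s - real d / 2 = real d / 2 - (s + real d)" by simp
      then have "X powr (- s - real d / 2) = X powr (real d / 2) / X powr (s + real d)"
        by (simp only: powr_diff)
      ultimately show ?thesis unfolding XD \<tau>_def by simp
    qed
    then show ?case
      using entropy_lower_bound[OF s elim(2) P0 less_imp_le[OF M] PM \<tau>_def[unfolded B_def X_def d_def] few[unfolded Q_def d_def] fine[unfolded d_def]]
      unfolding n_def X_def d_def by (simp only:)
  qed
qed

text \<open>
  For \<open>n\<close> of order \<open>N powr (d - \<beta>)\<close>, the product is at least a constant times \<open>N\<close> to the power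
  \<open>- s - d / 2 + (d - \<beta>) * \<alpha> = d * \<epsilon> - \<beta> * \<alpha>\<close>. The choice \<open>\<beta> = d * \<epsilon> / (2 * \<alpha>)\<close> makes this \<open>d * \<epsilon> / 2 > 0\<close>.
\<close>

theorem theorem6:
  fixes s M \<epsilon> :: real and \<Omega> :: "(real ^ 'd) set"
  assumes "\<Omega> = unit_cube" and "s \<ge> 0" and "M > 0" and "\<epsilon> > 0"
  shows "limsup (\<lambda>n. (SUP f \<in> {f. barron_norm s \<Omega> f \<le> 1}.
             INF f\<^sub>n \<in> Sigma_inf n M. L2_norm_on \<Omega> (\<lambda>x. f x - f\<^sub>n x))
           * ennreal (real n powr (1 / 2 + s / real CARD('d) + \<epsilon>))) = \<infinity>"
proof -
  define d where "d = real CARD('d)"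
  have d: "d \<ge> 1" using zero_less_card_finite[where 'a='d] unfolding d_def by linarith
  define \<alpha> where "\<alpha> = 1 / 2 + s / d + \<epsilon>"
  have \<alpha>: "\<alpha> > 0" "\<epsilon> < \<alpha>" using assms d by (auto simp: \<alpha>_def add_pos_nonneg)
  define \<beta> where "\<beta> = d * \<epsilon> / (2 * \<alpha>)"
  have \<beta>: "\<beta> > 0" "\<beta> < d" using \<alpha> d assms by (auto simp: \<beta>_def field_simps)
  define E where "E n = (SUP f \<in> {f. barron_norm s \<Omega> f \<le> 1}. INF f\<^sub>n \<in> Sigma_inf n M. L2_norm_on \<Omega> (\<lambda>x. f x - f\<^sub>n x))" for n
  define m where "m N = nat \<lfloor>real N powr (d - \<beta>)\<rfloor>" for N
  obtain c where c: "c > 0" and low: "\<forall>\<^sub>F N in sequentially. ennreal (c * real N powr (- s - d / 2)) \<le> E (m N)"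
    using error_lower_bound[where 'd='d, OF assms(2,3), of \<beta>] \<beta> unfolding E_def m_def d_def assms(1) by blast
  have "filterlim (\<lambda>x::real. x powr (d - \<beta>)) at_top at_top" using \<beta> by real_asymp
  then have lim: "filterlim (\<lambda>N. real N powr (d - \<beta>)) at_top sequentially"
    by (rule filterlim_compose[OF _ filterlim_real_sequentially])
  have "filterlim (\<lambda>x::real. c / 2 powr \<alpha> * x powr (d * \<epsilon> / 2)) at_top at_top"
    using c d assms(4) by real_asymp
  then have lim2: "filterlim (\<lambda>N. c / 2 powr \<alpha> * real N powr (d * \<epsilon> / 2)) at_top sequentially"
    by (rule filterlim_compose[OF _ filterlim_real_sequentially])
  \<comment> \<open>the values \<open>m N\<close> tend to infinity, so it is enough to bound the product there\<close>
  have big: "\<exists>n\<ge>n0. ennreal C \<le> E n * ennreal (real n powr \<alpha>)" for n0 C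
  proof -
    have "\<forall>\<^sub>F N in sequentially. real n0 + 1 \<le> real N powr (d - \<beta>)" "\<forall>\<^sub>F N in sequentially. C \<le> c / 2 powr \<alpha> * real N powr (d * \<epsilon> / 2)"
      using lim lim2 by (simp_all add: filterlim_at_top)
    with low have "\<forall>\<^sub>F N in sequentially. m N \<ge> n0 \<and> ennreal C \<le> E (m N) * ennreal (real (m N) powr \<alpha>)"
      using eventually_ge_at_top[of 1]
    proof eventually_elim
      case (elim N)
      define X where "X = real N"
      have X: "X \<ge> 1" using elim(4) by (simp add: X_def)
      have "X powr (d - \<beta>) \<ge> 1" using elim(2) by (simp add: X_def)
      then have m: "X powr (d - \<beta>) / 2 \<le> real (m N)"
      proof -
        have "y / 2 \<le> real (nat \<lfloor>y\<rfloor>)" if "1 \<le> y" for y :: real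
        proof -
          have "1 \<le> \<lfloor>y\<rfloor>" using that by simp
          then have "real (nat \<lfloor>y\<rfloor>) = of_int \<lfloor>y\<rfloor>" "1 \<le> real_of_int \<lfloor>y\<rfloor>" by simp_all
          then show ?thesis using real_of_int_floor_add_one_gt[of y] by linarith
        qed
        then show ?thesis using \<open>1 \<le> X powr (d - \<beta>)\<close> unfolding m_def X_def[symmetric] .
      qed
      have n0: "n0 \<le> m N" using elim(2) unfolding m_def by linarith
      have "c / 2 powr \<alpha> * X powr (d * \<epsilon> / 2) = (c * X powr (- s - d / 2)) * (X powr (d - \<beta>) / 2) powr \<alpha>"
      proof -
        have "(X powr (d - \<beta>) / 2) powr \<alpha> = X powr ((d - \<beta>) * \<alpha>) / 2 powr \<alpha>"
          using X by (simp add: powr_divide powr_powr)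
        moreover have "- s - d / 2 + (d - \<beta>) * \<alpha> = d * \<epsilon> / 2"
        proof -
          have "\<beta> * \<alpha> = d * \<epsilon> / 2" using \<alpha>(1) by (simp add: \<beta>_def)
          moreover have "d * \<alpha> = d / 2 + s + d * \<epsilon>" using d by (simp add: \<alpha>_def field_simps)
          ultimately show ?thesis by (simp add: left_diff_distrib)
        qed
        then have "X powr (- s - d / 2) * X powr ((d - \<beta>) * \<alpha>) = X powr (d * \<epsilon> / 2)"
          by (simp only: powr_add[symmetric])
        ultimately show ?thesis by (simp add: mult.assoc)
      qed
      also have "\<dots> \<le> (c * X powr (- s - d / 2)) * real (m N) powr \<alpha>"
        using m c \<alpha> X by (intro mult_left_mono powr_mono2) auto
      finally have "ennreal C \<le> ennreal ((c * X powr (- s - d / 2)) * real (m N) powr \<alpha>)"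
        using elim(3) by (intro ennreal_leI) (simp add: X_def)
      also have "\<dots> = ennreal (c * X powr (- s - d / 2)) * ennreal (real (m N) powr \<alpha>)"
        using c by (intro ennreal_mult) auto
      also have "\<dots> \<le> E (m N) * ennreal (real (m N) powr \<alpha>)"
        using elim(1) by (intro mult_right_mono) (auto simp: X_def)
      finally show ?case using n0 by blast
    qed
    then show ?thesis using eventually_happens[of _ sequentially] by fastforce
  qed
  have "(SUP n\<in>{n0..}. E n * ennreal (real n powr \<alpha>)) = \<infinity>" for n0
  proof (rule ccontr)
    define S where "S = (SUP n\<in>{n0..}. E n * ennreal (real n powr \<alpha>))"
    assume "(SUP n\<in>{n0..}. E n * ennreal (real n powr \<alpha>)) \<noteq> \<infinity>"
    then have S: "S = ennreal (enn2real S)" unfolding S_def[symmetric] by (simp add: less_top)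
    obtain n where n: "n \<ge> n0" "ennreal (enn2real S + 1) \<le> E n * ennreal (real n powr \<alpha>)" using big by blast
    note n(2)
    also have "E n * ennreal (real n powr \<alpha>) \<le> S" unfolding S_def using n(1) by (intro SUP_upper) auto
    also note S
    finally show False by (simp add: ennreal_le_iff)
  qed
  then have "limsup (\<lambda>n. E n * ennreal (real n powr \<alpha>)) = \<infinity>" by (simp add: limsup_INF_SUP)
  then show ?thesis unfolding E_def \<alpha>_def d_def .
qed

end
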